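(* Let $\lambda,\mu,k,r,m,n$ be positive integers with $\mu\ge\lambda$ and $m\ge n$. Suppose that $rk=\mu(m-1)$, $rm$ is even, $r\ge3$ and $2\mu>r(\mu-\lambda)$. Let $\mathcal{G}$ be an $(r-1)$-admissible decomposition of $\lambda K_n$ into $k$ colors. Then there exists a constant $C=C(\mu,\lambda,r)$, depending only on $\mu,\lambda,r$, such that if $m\ge(2-C)n+1$, then $\mathcal{G}$ can be enclosed in some $2$-edge-connected $r$-factorization of $\mu K_m$ (into $k$ colors).
   Context: Graphs are undirected and may have multiple edges but no loops. $\lambda K_n$ is the complete graph on $n$ vertices in which every pair of distinct vertices is joined by exactly $\lambda$ parallel edges; for $\lambda\le\mu$ and $n\le m$, $\lambda K_n$ is regarded as a subgraph of $\mu K_m$. A decomposition of a graph $G$ into $k$ colors is a collection $\mathcal{G}=\{\mathcal{G}(1),\dots,\mathcal{G}(k)\}$ of spanning subgraphs of $G$ (color classes), indexed by $1,\dots,k$, whose edge sets partition $E(G)$; color classes may have isolated vertices and may have no edges. A decomposition $\mathcal{G}$ of $\lambda K_n$ into $k$ colors is enclosed in a decomposition $\mathcal{H}$ of $\mu K_m$ into $k$ colors if $\mathcal{G}(i)$ is a subgraph of $\mathcal{H}(i)$ for every $1\le i\le k$. A $2$-edge-connected $r$-factorization of a graph is a decomposition of it in which every color class is an $r$-regular, $2$-edge-connected spanning subgraph. For an integer $s\ge2$, a decomposition $\mathcal{G}$ into $k$ colors (with vertex set $V(K_n)$) is $s$-admissible if: (1) $d_{\mathcal{G}(i)}(v)\le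 s$ for every vertex $v$ and every $1\le i\le k$, where $d_{\mathcal{G}(i)}(v)$ is the degree of $v$ in $\mathcal{G}(i)$; (2) every connected component of every $\mathcal{G}(i)$ contains a vertex of degree at most $s-2$ in $\mathcal{G}(i)$ or at least two vertices of degree at most $s-1$ in $\mathcal{G}(i)$; (3) if $D$ is a connected component of some $\mathcal{G}(i)$ and $e$ is a cutedge of $D$, then each of the two components of $D-e$ contains a vertex of degree at most $s-1$ in $\mathcal{G}(i)$. *)

theory Defs
  imports Complex_Main "HOL-Library.Multiset"
begin

text \<open>
  Undirected loopless multigraphs. An edge is represented by its two-element set of ends; parallel
  edges are repeated occurrences in the multiset of edges.
\<close>

record 'v mgraph =
  verts :: "'v set"
  edges :: "'v set multiset"

definition wf_mgraph :: "'v mgraph \<Rightarrow> bool" where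
  "wf_mgraph G \<longleftrightarrow> finite (verts G) \<and> (\<forall>e\<in>#edges G. e \<subseteq> verts G \<and> card e = 2)"

definition complete_mgraph :: "nat \<Rightarrow> nat \<Rightarrow> nat mgraph" where
  "complete_mgraph l n =
     \<lparr>verts = {..<n}, edges = repeat_mset l (mset_set {e. e \<subseteq> {..<n} \<and> card e = 2})\<rparr>"

definition subgraph :: "'v mgraph \<Rightarrow> 'v mgraph \<Rightarrow> bool" where
  "subgraph H G \<longleftrightarrow> wf_mgraph H \<and> wf_mgraph G \<and> verts H \<subseteq> verts G \<and> edges H \<subseteq># edges G"

definition spanning_subgraph :: "'v mgraph \<Rightarrow> 'v mgraph \<Rightarrow> bool" where
  "spanning_subgraph H G \<longleftrightarrow> subgraph H G \<and> verts H = verts G"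

definition deg :: "'v mgraph \<Rightarrow> 'v \<Rightarrow> nat" where
  "deg G v = size {#e \<in># edges G. v \<in> e#}"

definition regular :: "nat \<Rightarrow> 'v mgraph \<Rightarrow> bool" where
  "regular r G \<longleftrightarrow> (\<forall>v\<in>verts G. deg G v = r)"

definition reachable :: "'v mgraph \<Rightarrow> 'v \<Rightarrow> 'v \<Rightarrow> bool" where
  "reachable G = (\<lambda>u v. {u, v} \<in># edges G)\<^sup>*\<^sup>*"

definition connected_mgraph :: "'v mgraph \<Rightarrow> bool" where
  "connected_mgraph G \<longleftrightarrow> verts G \<noteq> {} \<and> (\<forall>u\<in>verts G. \<forall>v\<in>verts G. reachable G u v)"

definition induced :: "'v mgraph \<Rightarrow> 'v set \<Rightarrow> 'v mgraph" where
  "induced G X = \<lparr>verts = X, edges = {#e \<in># edges G. e \<subseteq> X#}\<rparr>"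

definition components :: "'v mgraph \<Rightarrow> 'v mgraph set" where
  "components G = {induced G {v \<in> verts G. reachable G u v} |u. u \<in> verts G}"

text \<open>Deletes one occurrence of the edge, so that edges parallel to it remain.\<close>

definition del_edge :: "'v mgraph \<Rightarrow> 'v set \<Rightarrow> 'v mgraph" where
  "del_edge G e = \<lparr>verts = verts G, edges = edges G - {#e#}\<rparr>"

definition cutedge :: "'v mgraph \<Rightarrow> 'v set \<Rightarrow> bool" where
  "cutedge G e \<longleftrightarrow> e \<in># edges G \<and> card (components (del_edge G e)) > card (components G)"

definition two_edge_connected :: "'v mgraph \<Rightarrow> bool" where
  "two_edge_connected G \<longleftrightarrow>
     connected_mgraph G \<and> (\<forall>e\<in>#edges G. connected_mgraph (del_edge G e))"

text \<open>
  A family of color classes is a function on the colors \<open>1, \<dots>, k\<close>; its values at other arguments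
  are irrelevant. The multiset equation says that the color classes partition the edges.
\<close>

definition decomposition :: "nat \<Rightarrow> (nat \<Rightarrow> 'v mgraph) \<Rightarrow> 'v mgraph \<Rightarrow> bool" where
  "decomposition k D G \<longleftrightarrow>
     (\<forall>i\<in>{1..k}. spanning_subgraph (D i) G) \<and> (\<Sum>i\<in>{1..k}. edges (D i)) = edges G"

definition enclosed :: "nat \<Rightarrow> (nat \<Rightarrow> 'v mgraph) \<Rightarrow> (nat \<Rightarrow> 'v mgraph) \<Rightarrow> bool" where
  "enclosed k D H \<longleftrightarrow> (\<forall>i\<in>{1..k}. subgraph (D i) (H i))"

definition two_edge_connected_factorization ::
    "nat \<Rightarrow> nat \<Rightarrow> (nat \<Rightarrow> 'v mgraph) \<Rightarrow> 'v mgraph \<Rightarrow> bool" where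
  "two_edge_connected_factorization r k D G \<longleftrightarrow>
     decomposition k D G \<and> (\<forall>i\<in>{1..k}. regular r (D i) \<and> two_edge_connected (D i))"

text \<open>
  Intended for \<open>s \<ge> 2\<close>, where the subtractions do not truncate. All degrees are taken in the whole
  color class, not in the component or in the component with the cutedge removed.
\<close>

definition admissible :: "nat \<Rightarrow> nat \<Rightarrow> (nat \<Rightarrow> 'v mgraph) \<Rightarrow> bool" where
  "admissible s k D \<longleftrightarrow>
     (\<forall>i\<in>{1..k}. \<forall>v\<in>verts (D i). deg (D i) v \<le> s) \<and>
     (\<forall>i\<in>{1..k}. \<forall>X\<in>components (D i).
        (\<exists>v\<in>verts X. deg (D i) v \<le> s - 2) \<or>
        (\<exists>u\<in>verts X. \<exists>v\<in>verts X. u \<noteq> v \<and> deg (D i) u \<le> s - 1 \<and> deg (D i) v \<le> s - 1)) \<and>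
     (\<forall>i\<in>{1..k}. \<forall>X\<in>components (D i). \<forall>e. cutedge X e \<longrightarrow>
        (\<forall>Y\<in>components (del_edge X e). \<exists>v\<in>verts Y. deg (D i) v \<le> s - 1))"

lemma subgraph_complete_mgraph:
  assumes "l \<le> l'" and "n \<le> n'"
  shows "subgraph (complete_mgraph l n) (complete_mgraph l' n')"
proof -
  have fin: "finite {e. e \<subseteq> {..<q} \<and> card e = 2}" for q :: nat
    by (rule finite_subset[of _ "Pow {..<q}"]) auto
  have wf: "wf_mgraph (complete_mgraph j q)" for j q
    using fin[of q]
    by (auto simp: wf_mgraph_def complete_mgraph_def count_mset_set' split: if_splits
        simp flip: count_greater_zero_iff)
  have "{e. e \<subseteq> {..<n} \<and> card e = 2} \<subseteq> {e. e \<subseteq> {..<n'} \<and> card e = 2}"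
    using assms(2) by fastforce
  then have "edges (complete_mgraph l n) \<subseteq># edges (complete_mgraph l' n')"
    using assms(1) fin[of n] fin[of n']
    by (auto simp: complete_mgraph_def subseteq_mset_def count_mset_set')
  then show ?thesis
    using wf assms(2) by (auto simp: subgraph_def complete_mgraph_def)
qed

end

theory Submission
  imports Defs
begin

text \<open>
  Since \<open>2 \<mu> > r (\<mu> - \<lambda>)\<close>, there are enough colors to split the edges of \<open>(\<mu> - \<lambda>) K\<^sub>n\<close> into one
  matching of linear size per color. Adding a matching to an \<open>(r - 1)\<close>-admissible color class keeps
  all degrees at most \<open>r\<close>, and joining every vertex to one new vertex \<open>w\<close> by as many edges as
  its degree falls short of \<open>r\<close> makes the class 2-edge-connected. The sizes of the matchings ensure
  that a nonnegative number of loops at \<open>w\<close> brings its degree to \<open>r (m - n)\<close>. The vertex \<open>w\<close> is then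
  split into \<open>m - n\<close> vertices, one at a time. With \<open>p\<close> vertices left to split off, the new vertex
  ideally receives a \<open>1 / p\<close> share of the edges at \<open>w\<close>, in every color, at every neighbor, and
  from every subtree of a spanning forest of the color class without \<open>w\<close>. These shares form a
  circulation in a network, so that they can be rounded simultaneously, and the rounded split
  preserves 2-edge-connectedness.
\<close>

section \<open>Rounding a circulation\<close>

text \<open>The obstacle is 2-edge-connectedness: it concerns every vertex set, while shares can be
  rounded together only along a laminar family. The subtrees of a spanning forest form such a family
  and suffice: a nonempty set with at most one leaving edge contains a whole component, is a
  subtree, or is a component minus a subtree. The constant comes from counting loops. A color of
  \<open>G\<close> may have no edges, so only its matching is sure to use up ends: the number of
  loops is nonnegative as soon as \<open>r * (2 * n - m)\<close> is at most the degree sum of the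
  matching. If \<open>m < 2 * n\<close>, a matching of about \<open>n / 2\<close> edges is shared by
  at most \<open>q = 2 * \<mu> + 1\<close> colors, so each color gets degree sum at least
  \<open>n / q - 2\<close>, and \<open>C = 1 / (r * q)\<close> is small enough. The strict
  inequality \<open>2 \<mu> > r (\<mu> - \<lambda>)\<close> between integers leaves a gap of one,
  which absorbs the loss \<open>C * \<mu> \<le> 1\<close> when the matchings are fitted into
  \<open>k\<close> colors.\<close>

lemma homogeneous_system_nontrivial:
  fixes M :: "'v \<Rightarrow> 'a \<Rightarrow> real"
  assumes "finite V" "finite A" "card V < card A"
  shows "\<exists>d. (\<exists>a\<in>A. d a \<noteq> 0) \<and> (\<forall>a. a \<notin> A \<longrightarrow> d a = 0)
    \<and> (\<forall>v\<in>V. (\<Sum>a\<in>A. M v a * d a) = 0)"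
  using assms
proof (induction V arbitrary: A M rule: finite_induct)
  case empty
  then obtain b where "b \<in> A" by fastforce
  then show ?case
    by (intro exI[of _ "\<lambda>a. if a = b then 1 else 0"]) auto
next
  case (insert v V)
  show ?case
  proof (cases "\<forall>a\<in>A. M v a = 0")
    case True
    obtain d where "(\<exists>a\<in>A. d a \<noteq> 0) \<and> (\<forall>a. a \<notin> A \<longrightarrow> d a = 0) \<and> (\<forall>v\<in>V. (\<Sum>a\<in>A. M v a * d a) = 0)"
      using insert.IH[of A M] insert.prems insert.hyps by auto
    with True show ?thesis by (intro exI[of _ d]) auto
  next
    case False
    then obtain b where b: "b \<in> A" "M v b \<noteq> 0" by blast
    \<comment> \<open>Gaussian elimination: equation \<open>v\<close> removes the unknown
      \<open>b\<close> from the other equations, and \<open>s\<close> below recovers its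
      value.\<close>
    define M' where "M' u a = M u a - M u b * M v a / M v b" for u a
    have "card V < card (A - {b})" using insert.prems insert.hyps b by auto
    then obtain d where d: "\<exists>a\<in>A - {b}. d a \<noteq> 0" "\<forall>a. a \<notin> A - {b} \<longrightarrow> d a = 0"
      "\<forall>u\<in>V. (\<Sum>a\<in>A - {b}. M' u a * d a) = 0"
      using insert.IH[of "A - {b}" M'] insert.prems by auto
    define s where "s = - (\<Sum>a\<in>A - {b}. M v a * d a) / M v b"
    define d' where "d' = d(b := s)"
    have split: "(\<Sum>a\<in>A. M u a * d' a) = M u b * s + (\<Sum>a\<in>A - {b}. M u a * d a)" for u
      using b insert.prems by (subst sum.remove[of A b]) (auto simp: d'_def intro!: sum.cong)
    have "(\<Sum>a\<in>A. M u a * d' a) = 0" if "u \<in> V" for u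
    proof -
      have "(\<Sum>a\<in>A - {b}. M' u a * d a)
          = (\<Sum>a\<in>A - {b}. M u a * d a) - M u b / M v b * (\<Sum>a\<in>A - {b}. M v a * d a)"
        by (simp add: M'_def algebra_simps sum_subtractf sum_distrib_left)
      with d(3) that b show ?thesis unfolding split s_def by (simp add: field_simps)
    qed
    moreover have "(\<Sum>a\<in>A. M v a * d' a) = 0" unfolding split s_def using b by simp
    moreover have "\<exists>a\<in>A. d' a \<noteq> 0" using d(1) by (auto simp: d'_def)
    moreover have "\<forall>a. a \<notin> A \<longrightarrow> d' a = 0" using d(2) b by (auto simp: d'_def)
    ultimately show ?thesis by blast
  qed
qed

text \<open>The values are polymorphic because both the fractional (\<open>real\<close>) and the
  rounded (\<open>int\<close>) flow are circulations on the same arcs. There are no capacities; the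
  bounds are kept separately.\<close>

definition circulation :: "'a set \<Rightarrow> ('a \<Rightarrow> 'v) \<Rightarrow> ('a \<Rightarrow> 'v) \<Rightarrow> ('a \<Rightarrow> 'b::comm_monoid_add) \<Rightarrow> bool" where
  "circulation A src tgt f \<longleftrightarrow> (\<forall>v. sum f {a \<in> A. tgt a = v} = sum f {a \<in> A. src a = v})"

text \<open>If a single fractional arc met \<open>v\<close>, conservation would write its value as a
  signed sum of integers. A loop at \<open>v\<close> counts twice and cancels.\<close>

lemma circulation_fractional_incidence:
  fixes f :: "'a \<Rightarrow> real" and src tgt :: "'a \<Rightarrow> 'v"
  assumes fin: "finite A" and circ: "circulation A src tgt f"
    and N: "N = {a \<in> A. f a \<notin> \<int>}" and v: "v \<in> tgt ` N \<union> src ` N"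
  shows "2 \<le> card {a \<in> N. tgt a = v} + card {a \<in> N. src a = v}"
proof (rule ccontr)
  assume "\<not> ?thesis"
  then have lt: "card {a \<in> N. tgt a = v} + card {a \<in> N. src a = v} \<le> 1" by simp
  have finN: "finite N" using fin N by simp
  have split: "sum f {a \<in> A. g a = v} = sum f {a \<in> N. g a = v} + sum f {a \<in> A - N. g a = v}"
    for g :: "'a \<Rightarrow> 'v"
    using fin by (subst sum.union_disjoint[symmetric]) (auto simp: N intro!: sum.cong)
  have int: "sum f {a \<in> A - N. g a = v} \<in> \<int>" for g :: "'a \<Rightarrow> 'v"
    by (rule Ints_sum) (auto simp: N)
  have eq: "sum f {a \<in> N. tgt a = v} - sum f {a \<in> N. src a = v} \<in> \<int>"
  proof -
    have "sum f {a \<in> N. tgt a = v} - sum f {a \<in> N. src a = v}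
        = sum f {a \<in> A - N. src a = v} - sum f {a \<in> A - N. tgt a = v}"
      using circ[unfolded circulation_def, rule_format, of v] split[of tgt] split[of src] by linarith
    then show ?thesis using Ints_diff[OF int[of src] int[of tgt]] by simp
  qed
  have single: "card S = 0 \<or> card S = 1 \<Longrightarrow> a \<in> S \<Longrightarrow> S = {a}" if "S \<subseteq> N" for S a
    using that finN by (metis card_0_eq card_1_singletonE empty_iff finite_subset singletonD)
  have sub: "{a \<in> N. g a = v} \<subseteq> N" for g :: "'a \<Rightarrow> 'v" by blast
  from v consider a where "a \<in> {a \<in> N. tgt a = v}" | a where "a \<in> {a \<in> N. src a = v}" by auto
  then show False
  proof cases
    case 1
    then have "card {a \<in> N. tgt a = v} \<noteq> 0" using finN by auto
    then have one: "{a \<in> N. tgt a = v} = {a}" and "card {a \<in> N. src a = v} = 0"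
      using lt 1 by (intro single sub, linarith+)
    then have zero: "{a \<in> N. src a = v} = {}" using finN by simp
    have "f a \<in> \<int>" using eq unfolding one zero by simp
    then show False using 1 N by simp
  next
    case 2
    then have "card {a \<in> N. src a = v} \<noteq> 0" using finN by auto
    then have one: "{a \<in> N. src a = v} = {a}" and "card {a \<in> N. tgt a = v} = 0"
      using lt 2 by (intro single sub, linarith+)
    then have zero: "{a \<in> N. tgt a = v} = {}" using finN by simp
    have "f a \<in> \<int>" using eq unfolding one zero by simp
    then show False using 2 N by simp
  qed
qed

text \<open>By the incidence bound the fractional arcs touch at most \<open>card N\<close> vertices.
  The net flows add up to zero, so conservation at one vertex follows from the others; this leaves
  fewer equations than the \<open>card N\<close> unknowns.\<close>

lemma circulation_fractional_direction:
  fixes f :: "'a \<Rightarrow> real" and src tgt :: "'a \<Rightarrow> 'v"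
  assumes fin: "finite A" and circ: "circulation A src tgt f"
    and N: "N = {a \<in> A. f a \<notin> \<int>}" and ne: "N \<noteq> {}"
  shows "\<exists>d :: 'a \<Rightarrow> real. (\<exists>a\<in>N. d a \<noteq> 0) \<and> (\<forall>a. a \<notin> N \<longrightarrow> d a = 0) \<and> circulation A src tgt d"
proof -
  define T where "T = tgt ` N \<union> src ` N"
  have finN: "finite N" using fin N by simp
  then have finT: "finite T" by (simp add: T_def)
  have count: "(\<Sum>v\<in>T. card {a \<in> N. g a = v}) = card N" if "g ` N \<subseteq> T" for g :: "'a \<Rightarrow> 'v"
    using sum.group[OF finN finT that, of "\<lambda>_. 1::nat"] by simp
  have "2 * card T \<le> (\<Sum>v\<in>T. card {a \<in> N. tgt a = v} + card {a \<in> N. src a = v})"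
    using sum_mono[of T "\<lambda>_. 2::nat"] circulation_fractional_incidence[OF fin circ N]
    by (fastforce simp: T_def mult.commute)
  also have "\<dots> = 2 * card N"
    using count[of tgt] count[of src] by (simp add: sum.distrib T_def)
  finally have le: "card T \<le> card N" by simp
  from ne obtain a0 where "a0 \<in> N" by blast
  then have t: "tgt a0 \<in> T" by (simp add: T_def)
  let ?t = "tgt a0"
  have "card (T - {?t}) < card N"
    using le t finT by (metis card_Diff1_less less_le_trans)
  then obtain d :: "'a \<Rightarrow> real" where d: "\<exists>a\<in>N. d a \<noteq> 0" "\<forall>a. a \<notin> N \<longrightarrow> d a = 0"
    "\<forall>v\<in>T - {?t}. (\<Sum>a\<in>N. (of_bool (tgt a = v) - of_bool (src a = v)) * d a) = 0"
    using homogeneous_system_nontrivial[of "T - {?t}" N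
        "\<lambda>v a. of_bool (tgt a = v) - of_bool (src a = v)"] finT finN by blast
  define net where "net v = sum d {a \<in> N. tgt a = v} - sum d {a \<in> N. src a = v}" for v
  have net: "net v = (\<Sum>a\<in>N. (of_bool (tgt a = v) - of_bool (src a = v)) * d a)" for v
  proof -
    have "sum d {a \<in> N. g a = v} = (\<Sum>a\<in>N. of_bool (g a = v) * d a)" for g :: "'a \<Rightarrow> 'v"
      unfolding sum.inter_filter[OF finN] by (rule sum.cong) auto
    then show ?thesis by (simp add: net_def algebra_simps sum_subtractf)
  qed
  have "sum net T = 0"
    using sum.group[OF finN finT, of tgt d] sum.group[OF finN finT, of src d]
    by (simp add: net_def sum_subtractf T_def)
  moreover have "sum net T = net ?t + sum net (T - {?t})"
    using finT t by (rule sum.remove)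
  moreover have "sum net (T - {?t}) = 0" using d(3) by (simp add: net)
  ultimately have "net ?t = 0" by simp
  then have net0: "net v = 0" if "v \<in> T" for v
    using d(3) that net by (cases "v = ?t") auto
  have "net v = 0" for v
  proof (cases "v \<in> T")
    case False
    then have "{a \<in> N. tgt a = v} = {}" "{a \<in> N. src a = v} = {}" by (auto simp: T_def)
    then show ?thesis by (simp only: net_def)
  qed (rule net0)
  moreover have "sum d {a \<in> A. g a = v} = sum d {a \<in> N. g a = v}" for v and g :: "'a \<Rightarrow> 'v"
    using fin d(2) by (intro sum.mono_neutral_right) (auto simp: N)
  ultimately have "circulation A src tgt d"
    by (simp add: circulation_def net_def)
  with d(1,2) show ?thesis by blast
qed

lemma circulation_add_scaled:
  fixes f d :: "'a \<Rightarrow> real"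
  assumes "circulation A src tgt f" "circulation A src tgt d"
  shows "circulation A src tgt (\<lambda>a. f a + s * d a)"
  using assms by (simp add: circulation_def sum.distrib sum_distrib_left[symmetric])

text \<open>Moving along a direction supported on the fractional arcs, up to the first time that one
  of them becomes integral, crosses no integer and lowers the number of fractional arcs.\<close>

theorem circulation_rounding:
  fixes f :: "'a \<Rightarrow> real" and src tgt :: "'a \<Rightarrow> 'v"
  assumes "finite A" and "circulation A src tgt f"
  obtains g :: "'a \<Rightarrow> int" where "circulation A src tgt g"
    "\<And>a. a \<in> A \<Longrightarrow> \<lfloor>f a\<rfloor> \<le> g a" "\<And>a. a \<in> A \<Longrightarrow> g a \<le> \<lceil>f a\<rceil>"
proof -
  have "\<exists>g :: 'a \<Rightarrow> int. circulation A src tgt g \<and> (\<forall>a\<in>A. \<lfloor>f a\<rfloor> \<le> g a \<and> g a \<le> \<lceil>f a\<rceil>)"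
    using assms(2)
  proof (induction "card {a \<in> A. f a \<notin> \<int>}" arbitrary: f rule: less_induct)
    case less
    define N where "N = {a \<in> A. f a \<notin> \<int>}"
    show ?case
    proof (cases "N = {}")
      case True
      then have int: "real_of_int \<lfloor>f a\<rfloor> = f a" if "a \<in> A" for a
        using that by (auto simp: N_def elim!: Ints_cases)
      have "real_of_int (\<Sum>a | a \<in> A \<and> g a = v. \<lfloor>f a\<rfloor>) = sum f {a \<in> A. g a = v}"
        for v and g :: "'a \<Rightarrow> 'v"
        by (simp add: int)
      then have "circulation A src tgt (\<lambda>a. \<lfloor>f a\<rfloor>)"
        using less.prems unfolding circulation_def by (metis of_int_eq_iff)
      then show ?thesis by (intro exI[of _ "\<lambda>a. \<lfloor>f a\<rfloor>"]) (simp add: floor_le_ceiling)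
    next
      case False
      obtain d :: "'a \<Rightarrow> real" where d: "\<exists>a\<in>N. d a \<noteq> 0" "\<forall>a. a \<notin> N \<longrightarrow> d a = 0" "circulation A src tgt d"
        using circulation_fractional_direction[OF assms(1) less.prems N_def False] by blast
      define P where "P = {a \<in> N. d a \<noteq> 0}"
      \<comment> \<open>The step length at which arc \<open>a\<close> reaches the next integer in
        the direction of \<open>d\<close>; the minimum \<open>s\<close> is the first such
        time.\<close>
      define \<tau> where "\<tau> a = ((if 0 < d a then \<lceil>f a\<rceil> else \<lfloor>f a\<rfloor>) - f a) / d a" for a
      define s where "s = Min (\<tau> ` P)"
      have finP: "finite P" "P \<noteq> {}" using assms(1) d(1) by (auto simp: P_def N_def)
      have pos: "0 < \<tau> a" if "a \<in> P" for a
      proof -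
        have ne: "real_of_int \<lfloor>f a\<rfloor> \<noteq> f a" "real_of_int \<lceil>f a\<rceil> \<noteq> f a"
          using that by (auto simp: P_def N_def)
        then have "real_of_int \<lfloor>f a\<rfloor> < f a" "f a < real_of_int \<lceil>f a\<rceil>"
          using of_int_floor_le[of "f a"] le_of_int_ceiling[of "f a"] by linarith+
        then show ?thesis using that
          by (auto simp: \<tau>_def P_def divide_pos_pos divide_neg_neg)
      qed
      have s_in: "s \<in> \<tau> ` P" unfolding s_def using finP by (intro Min_in) auto
      then have s0: "0 < s" using pos by auto
      have s_le: "s \<le> \<tau> a" if "a \<in> P" for a unfolding s_def using finP that by auto
      define f' where "f' a = f a + s * d a" for a
      have bounds: "real_of_int \<lfloor>f a\<rfloor> \<le> f' a \<and> f' a \<le> real_of_int \<lceil>f a\<rceil>" for a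
      proof (cases "a \<in> P")
        case True
        consider "0 < d a" | "d a < 0" using True unfolding P_def by fastforce
        then show ?thesis
        proof cases
          case 1
          then have "s * d a \<le> \<lceil>f a\<rceil> - f a"
            using s_le[OF True] by (simp add: \<tau>_def pos_le_divide_eq)
          moreover have "0 \<le> s * d a" using 1 s0 by simp
          ultimately show ?thesis unfolding f'_def using of_int_floor_le[of "f a"] by linarith
        next
          case 2
          then have "\<lfloor>f a\<rfloor> - f a \<le> s * d a"
            using s_le[OF True] by (simp add: \<tau>_def neg_le_divide_eq)
          moreover have "s * d a \<le> 0" using 2 s0 by (simp add: mult_le_0_iff)
          ultimately show ?thesis unfolding f'_def using le_of_int_ceiling[of "f a"] by linarith
        qed
      next
        case False
        then have "d a = 0" using d(2) by (auto simp: P_def)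
        then show ?thesis by (simp add: f'_def)
      qed
      from s_in obtain b where b: "b \<in> P" "s = \<tau> b" by blast
      then have "f' b \<in> \<int>" by (auto simp: f'_def \<tau>_def P_def)
      moreover have "{a \<in> A. f' a \<notin> \<int>} \<subseteq> N"
      proof
        fix a assume "a \<in> {a \<in> A. f' a \<notin> \<int>}"
        then show "a \<in> N" using d(2) by (cases "a \<in> N") (auto simp: f'_def N_def)
      qed
      ultimately have "{a \<in> A. f' a \<notin> \<int>} \<subset> {a \<in> A. f a \<notin> \<int>}"
        using b(1) by (auto simp: P_def N_def)
      then have "card {a \<in> A. f' a \<notin> \<int>} < card {a \<in> A. f a \<notin> \<int>}"
        using assms(1) by (intro psubset_card_mono) auto
      moreover have "circulation A src tgt f'"
        unfolding f'_def using less.prems d(3) by (rule circulation_add_scaled)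
      ultimately obtain g :: "'a \<Rightarrow> int"
        where g: "circulation A src tgt g" "\<forall>a\<in>A. \<lfloor>f' a\<rfloor> \<le> g a \<and> g a \<le> \<lceil>f' a\<rceil>"
        using less.hyps by blast
      \<comment> \<open>Hence a rounding of \<open>f'\<close> is also a rounding of
        \<open>f\<close>.\<close>
      have "\<lfloor>f a\<rfloor> \<le> \<lfloor>f' a\<rfloor>" "\<lceil>f' a\<rceil> \<le> \<lceil>f a\<rceil>" for a
        using bounds[of a] by (simp_all add: le_floor_iff ceiling_le_iff)
      with g show ?thesis by (meson order_trans)
    qed
  qed
  with that show ?thesis by blast
qed

section \<open>Simultaneous rounding on trees\<close>

text \<open>The subtree below \<open>v\<close>. It stands outside the locale so that statements can
  speak of many parent maps on the same vertices.\<close>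

definition desc :: "'v set \<Rightarrow> ('v \<Rightarrow> 'v) \<Rightarrow> 'v \<Rightarrow> 'v set" where
  "desc V par v = {x \<in> V. \<exists>j. (par ^^ j) x = v}"

text \<open>The root is a fixed point of \<open>par\<close>; a rank that falls towards it excludes
  all other cycles and serves as the induction measure.\<close>

locale rooted_tree =
  fixes V :: "'v set" and w :: 'v and par :: "'v \<Rightarrow> 'v" and rank :: "'v \<Rightarrow> nat"
  assumes finite_V: "finite V" and root_in: "w \<in> V" and par_root: "par w = w"
    and par_in: "v \<in> V \<Longrightarrow> par v \<in> V"
    and rank_par: "v \<in> V \<Longrightarrow> v \<noteq> w \<Longrightarrow> rank (par v) < rank v"
begin

definition children :: "'v \<Rightarrow> 'v set" where
  "children v = {c \<in> V. c \<noteq> w \<and> par c = v}"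

lemma desc_subset: "desc V par v \<subseteq> V"
  by (auto simp: desc_def)

lemma finite_desc [simp]: "finite (desc V par v)"
  using desc_subset finite_V by (rule finite_subset)

lemma self_in_desc: "v \<in> V \<Longrightarrow> v \<in> desc V par v"
  by (auto simp: desc_def intro: exI[of _ 0])

lemma desc_up: "x \<in> desc V par v \<Longrightarrow> x \<noteq> v \<Longrightarrow> par x \<in> desc V par v"
proof -
  assume x: "x \<in> desc V par v" "x \<noteq> v"
  then obtain j where j: "(par ^^ j) x = v" "x \<in> V" unfolding desc_def by blast
  then obtain i where "j = Suc i" using x(2) by (cases j) auto
  with j have "(par ^^ i) (par x) = v" by (simp add: funpow_Suc_right del: funpow.simps)
  with par_in[OF j(2)] show ?thesis unfolding desc_def by blast
qed

lemma desc_down: "x \<in> V \<Longrightarrow> par x \<in> desc V par v \<Longrightarrow> x \<in> desc V par v"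
proof -
  assume "x \<in> V" "par x \<in> desc V par v"
  then obtain j where "(par ^^ Suc j) x = v" by (auto simp: desc_def funpow_Suc_right simp del: funpow.simps)
  with \<open>x \<in> V\<close> show ?thesis unfolding desc_def by blast
qed

lemma rank_iterate: "x \<in> V \<Longrightarrow> (par ^^ j) x \<in> V \<and> rank ((par ^^ j) x) \<le> rank x"
proof (induction j)
  case (Suc j)
  let ?y = "(par ^^ j) x"
  have "rank (par ?y) \<le> rank ?y"
    using Suc rank_par[of ?y] par_root by (cases "?y = w") auto
  with Suc par_in show ?case by simp
qed simp

lemma rank_desc: "x \<in> desc V par v \<Longrightarrow> v \<in> V \<and> rank v \<le> rank x"
  using rank_iterate by (auto simp: desc_def)

lemma desc_root: "desc V par w = V"
proof -
  have "x \<in> desc V par w" if "x \<in> V" for x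
    using that
  proof (induction "rank x" arbitrary: x rule: less_induct)
    case less
    show ?case
    proof (cases "x = w")
      case True
      then show ?thesis using self_in_desc root_in by simp
    next
      case False
      then show ?thesis using less rank_par par_in desc_down by blast
    qed
  qed
  with desc_subset show ?thesis by blast
qed

text \<open>Both \<open>a\<close> and \<open>b\<close> lie on the path from \<open>x\<close> to the
  root, so one comes before the other. This is the laminarity of the subtrees.\<close>

lemma desc_comparable:
  assumes "x \<in> desc V par a" "x \<in> desc V par b"
  shows "a \<in> desc V par b \<or> b \<in> desc V par a"
proof -
  from assms obtain i j where ij: "(par ^^ i) x = a" "(par ^^ j) x = b" and x: "x \<in> V"
    by (auto simp: desc_def)
  have V: "a \<in> V" "b \<in> V" using assms rank_desc by blast+
  show ?thesis
  proof (cases "i \<le> j")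
    case True
    then have "(par ^^ (j - i)) a = b" using ij by (metis comp_apply funpow_add le_add_diff_inverse2)
    then show ?thesis using V by (auto simp: desc_def)
  next
    case False
    then have "(par ^^ (i - j)) b = a"
      using ij by (metis comp_apply funpow_add le_add_diff_inverse2 nat_le_linear)
    then show ?thesis using V by (auto simp: desc_def)
  qed
qed

lemma desc_child_subset: "c \<in> children v \<Longrightarrow> desc V par c \<subseteq> desc V par v"
proof
  fix x assume "c \<in> children v" "x \<in> desc V par c"
  then obtain j where "(par ^^ j) x = c" "x \<in> V" "par c = v" by (auto simp: desc_def children_def)
  then have "(par ^^ Suc j) x = v" by simp
  with \<open>x \<in> V\<close> show "x \<in> desc V par v" unfolding desc_def by blast
qed

lemma parent_notin_desc_child: "c \<in> children v \<Longrightarrow> v \<notin> desc V par c"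
  using rank_desc[of v c] rank_par[of c] by (auto simp: children_def)

lemma desc_children_disjoint:
  assumes "c \<in> children v" "c' \<in> children v" "c \<noteq> c'"
  shows "desc V par c \<inter> desc V par c' = {}"
proof (rule ccontr)
  have no: "a \<notin> desc V par b" if "a \<in> children v" "b \<in> children v" "a \<noteq> b" for a b
    using that desc_up[of a b] parent_notin_desc_child[of b v] by (auto simp: children_def)
  assume "\<not> ?thesis"
  then obtain x where "x \<in> desc V par c" "x \<in> desc V par c'" by blast
  with desc_comparable no assms show False by metis
qed

lemma desc_rec:
  assumes "v \<in> V"
  shows "desc V par v = insert v (\<Union>c\<in>children v. desc V par c)"
proof
  show "desc V par v \<subseteq> insert v (\<Union>c\<in>children v. desc V par c)"
  proof
    fix x assume "x \<in> desc V par v"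
    then show "x \<in> insert v (\<Union>c\<in>children v. desc V par c)"
    proof (induction "rank x" arbitrary: x rule: less_induct)
      case less
      show ?case
      proof (cases "x = v")
        case False
        have xV: "x \<in> V" using less.prems desc_subset by blast
        have xw: "x \<noteq> w"
        proof
          assume "x = w"
          moreover have "(par ^^ j) w = w" for j by (induction j) (auto simp: par_root)
          ultimately show False using less.prems False by (auto simp: desc_def)
        qed
        show ?thesis
        proof (cases "par x = v")
          case True
          then have "x \<in> children v" using xV xw by (simp add: children_def)
          then show ?thesis using self_in_desc[OF xV] by blast
        next
          case pv: False
          have "par x \<in> insert v (\<Union>c\<in>children v. desc V par c)"
            using less.hyps[of "par x"] rank_par xV xw desc_up[OF less.prems False] by blast
          with pv desc_down[OF xV] show ?thesis by blast
        qed
      qed simp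
    qed
  qed
  show "insert v (\<Union>c\<in>children v. desc V par c) \<subseteq> desc V par v"
    using self_in_desc[OF assms] desc_child_subset by blast
qed

lemma finite_children: "finite (children v)"
  using finite_V by (simp add: children_def)

text \<open>This recursion is flow conservation at a tree node of the rounding network.\<close>

lemma sum_desc:
  assumes "v \<in> V"
  shows "sum f (desc V par v) = f v + (\<Sum>c\<in>children v. sum f (desc V par c))"
proof -
  have "sum f (\<Union>c\<in>children v. desc V par c) = (\<Sum>c\<in>children v. sum f (desc V par c))"
    using finite_children desc_children_disjoint by (intro sum.UNION_disjoint) auto
  moreover have "v \<notin> (\<Union>c\<in>children v. desc V par c)"
    using parent_notin_desc_child by blast
  ultimately show ?thesis
    unfolding desc_rec[OF assms] using finite_children by (subst sum.insert) auto
qed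

end

text \<open>\<open>Hub\<close> closes the flow into a circulation: it feeds the vertices and absorbs
  what leaves the roots. Column totals, single entries and subtree sums thus all appear as arcs of
  one network.\<close>

datatype ('c, 'v) tree_node = Hub | Elem 'v | Tree 'c 'v
datatype ('c, 'v) tree_arc = Elem_arc 'v | Leaf_arc 'c 'v | Tree_arc 'c 'v

text \<open>An integral \<open>q\<close> leaves no choice for \<open>z\<close>; this is how totals
  that are already integral survive the rounding exactly.\<close>

definition rounds :: "int \<Rightarrow> real \<Rightarrow> bool" where
  "rounds z q \<longleftrightarrow> \<lfloor>q\<rfloor> \<le> z \<and> z \<le> \<lceil>q\<rceil>"

text \<open>
  The flow enters at a vertex, is distributed to its copies in the trees, and is collected up each
  tree, so that the arc leaving a tree node carries the sum over its subtree.
\<close>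

theorem simultaneous_tree_rounding:
  fixes x :: "'c \<Rightarrow> 'v \<Rightarrow> real"
  assumes finI: "finite I" and finV: "finite V" and tree: "\<And>i. i \<in> I \<Longrightarrow> rooted_tree V w (par i) (rank i)"
  shows "\<exists>y. (\<forall>v\<in>V. rounds (\<Sum>i\<in>I. y i v) (\<Sum>i\<in>I. x i v)) \<and>
    (\<forall>i\<in>I. \<forall>v\<in>V. rounds (y i v) (x i v) \<and>
      rounds (sum (y i) (desc V (par i) v)) (sum (x i) (desc V (par i) v)))"
proof -
  define A where "A = Elem_arc ` V \<union> (\<lambda>(i, v). Leaf_arc i v) ` (I \<times> V) \<union> (\<lambda>(i, v). Tree_arc i v) ` (I \<times> V)"
  define src :: "('c, 'v) tree_arc \<Rightarrow> ('c, 'v) tree_node" where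
    "src a = (case a of Elem_arc v \<Rightarrow> Hub | Leaf_arc i v \<Rightarrow> Elem v | Tree_arc i v \<Rightarrow> Tree i v)" for a
  define tgt :: "('c, 'v) tree_arc \<Rightarrow> ('c, 'v) tree_node" where
    "tgt a = (case a of Elem_arc v \<Rightarrow> Elem v | Leaf_arc i v \<Rightarrow> Tree i v
      | Tree_arc i v \<Rightarrow> if v = w then Hub else Tree i (par i v))" for a
  define f where "f a = (case a of Elem_arc v \<Rightarrow> \<Sum>i\<in>I. x i v | Leaf_arc i v \<Rightarrow> x i v
    | Tree_arc i v \<Rightarrow> sum (x i) (desc V (par i) v))" for a
  have finA: "finite A" using finI finV by (simp add: A_def)
  have into_elem: "{a \<in> A. tgt a = Elem v} = (if v \<in> V then {Elem_arc v} else {})"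
    and from_elem: "{a \<in> A. src a = Elem v} = (if v \<in> V then (\<lambda>i. Leaf_arc i v) ` I else {})" for v
    by (auto simp: A_def src_def tgt_def split: if_splits)
  have into_tree: "{a \<in> A. tgt a = Tree i v} = (if i \<in> I \<and> v \<in> V then
      insert (Leaf_arc i v) (Tree_arc i ` rooted_tree.children V w (par i) v) else {})"
    and from_tree: "{a \<in> A. src a = Tree i v} = (if i \<in> I \<and> v \<in> V then {Tree_arc i v} else {})" for i v
    using tree rooted_tree.par_in[OF tree]
    by (auto simp: A_def src_def tgt_def rooted_tree.children_def[OF tree] split: if_splits)
  have into_hub: "{a \<in> A. tgt a = Hub} = (if V = {} then {} else (\<lambda>i. Tree_arc i w) ` I)"
    and from_hub: "{a \<in> A. src a = Hub} = Elem_arc ` V"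
    using rooted_tree.root_in[OF tree] by (auto simp: A_def src_def tgt_def split: if_splits)
  have tree_sum: "sum g {a \<in> A. tgt a = Tree i v}
      = g (Leaf_arc i v) + (\<Sum>c\<in>rooted_tree.children V w (par i) v. g (Tree_arc i c))"
    if "i \<in> I" "v \<in> V" for g :: "('c, 'v) tree_arc \<Rightarrow> 'n::comm_monoid_add" and i v
  proof -
    have "finite (rooted_tree.children V w (par i) v)"
      using rooted_tree.finite_children[OF tree[OF that(1)]] .
    then show ?thesis unfolding into_tree using that
      by (simp add: image_iff sum.reindex inj_on_def)
  qed
  have "circulation A src tgt f"
    unfolding circulation_def
  proof
    fix n
    show "sum f {a \<in> A. tgt a = n} = sum f {a \<in> A. src a = n}"
    proof (cases n)
      case Hub
      have "(\<Sum>v\<in>V. \<Sum>i\<in>I. x i v) = (\<Sum>i\<in>I. sum (x i) (desc V (par i) w))"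
        using rooted_tree.desc_root[OF tree] by (subst sum.swap) simp
      then show ?thesis unfolding Hub into_hub from_hub
        by (auto simp: f_def sum.reindex inj_on_def)
    next
      case (Elem v)
      then show ?thesis by (simp add: into_elem from_elem f_def sum.reindex inj_on_def)
    next
      case (Tree i v)
      show ?thesis
      proof (cases "i \<in> I \<and> v \<in> V")
        case True
        then show ?thesis
          using rooted_tree.sum_desc[OF tree, of i v "x i"] by (simp add: Tree tree_sum from_tree f_def)
      next
        case False
        then show ?thesis by (simp only: Tree into_tree from_tree if_False)
      qed
    qed
  qed
  then obtain g :: "('c, 'v) tree_arc \<Rightarrow> int" where circ: "circulation A src tgt g"
    and g: "\<And>a. a \<in> A \<Longrightarrow> rounds (g a) (f a)"
    using circulation_rounding[OF finA] unfolding rounds_def by metis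
  define y where "y i v = g (Leaf_arc i v)" for i v
  have elem: "g (Elem_arc v) = (\<Sum>i\<in>I. y i v)" if "v \<in> V" for v
    using circ[unfolded circulation_def, rule_format, of "Elem v"] that
    by (simp add: into_elem from_elem y_def sum.reindex inj_on_def)
  \<comment> \<open>Conservation determines the tree arcs from the leaf arcs, from the bottom of the
    tree upwards.\<close>
  have subtree: "g (Tree_arc i v) = sum (y i) (desc V (par i) v)" if "i \<in> I" "v \<in> V" for i v
    using that
  proof (induction "card (desc V (par i) v)" arbitrary: v rule: less_induct)
    case less
    interpret rooted_tree V w "par i" "rank i" using tree less.prems by blast
    have "card (desc V (par i) c) < card (desc V (par i) v)" if "c \<in> children v" for c
      using desc_child_subset[OF that] parent_notin_desc_child[OF that] self_in_desc[OF less.prems(2)]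
      by (intro psubset_card_mono) auto
    then have "g (Tree_arc i c) = sum (y i) (desc V (par i) c)" if "c \<in> children v" for c
      using that less by (auto simp: children_def)
    moreover have "g (Tree_arc i v) = g (Leaf_arc i v) + (\<Sum>c\<in>children v. g (Tree_arc i c))"
      using circ[unfolded circulation_def, rule_format, of "Tree i v"] less.prems
      by (simp add: tree_sum from_tree)
    ultimately show ?case using sum_desc[OF less.prems(2), of "y i"] by (simp add: y_def)
  qed
  show ?thesis
  proof (intro exI[of _ y] conjI ballI)
    fix v assume "v \<in> V"
    then show "rounds (\<Sum>i\<in>I. y i v) (\<Sum>i\<in>I. x i v)"
      using g[of "Elem_arc v"] elem by (simp add: A_def f_def)
  next
    fix i v assume "i \<in> I" "v \<in> V"
    then show "rounds (y i v) (x i v)"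
      and "rounds (sum (y i) (desc V (par i) v)) (sum (x i) (desc V (par i) v))"
      using g[of "Leaf_arc i v"] g[of "Tree_arc i v"] subtree[of i v]
      by (simp_all add: A_def f_def y_def image_iff)
  qed
qed

section \<open>Cuts and spanning forests\<close>

text \<open>Edges to the amalgamated vertex are left out; they are counted by the deficits of the
  vertices in \<open>X\<close>.\<close>

definition cut_size :: "(nat set \<Rightarrow> nat) \<Rightarrow> nat \<Rightarrow> nat set \<Rightarrow> nat" where
  "cut_size a t X = (\<Sum>u\<in>X. \<Sum>v\<in>{..<t} - X. a {u, v})"

text \<open>A breadth-first tree is grown in each component from its least vertex, and
  \<open>t\<close> is added as a common artificial root. Links to \<open>t\<close> are not edges;
  the last clause holds because the subtree of a child of \<open>t\<close> is a whole
  component.\<close>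

lemma spanning_forest:
  fixes a :: "nat set \<Rightarrow> nat"
  shows "\<exists>par rank. rooted_tree {..t} t par rank \<and> (\<forall>v<t. par v < t \<longrightarrow> 0 < a {v, par v}) \<and>
    (\<forall>z<t. par z = t \<longrightarrow> cut_size a t (desc {..t} par z) = 0)"
proof -
  define E where "E = {(u, v). u < t \<and> v < t \<and> 0 < a {u, v}}"
  have symE: "sym E" by (auto simp: E_def sym_def insert_commute)
  \<comment> \<open>\<open>rt v\<close> is the least vertex in the component of \<open>v\<close>,
    and \<open>dist v\<close> is the distance from it.\<close>
  define rt where "rt v = (LEAST u. (u, v) \<in> E\<^sup>*)" for v
  define dist where "dist v = (LEAST n. (rt v, v) \<in> E ^^ n)" for v
  have rt_reach: "(rt v, v) \<in> E\<^sup>*" for v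
    unfolding rt_def by (rule LeastI[of _ v]) simp
  have rt_eq: "rt u = rt v" if "(u, v) \<in> E" for u v
  proof -
    have "(x, u) \<in> E\<^sup>* \<longleftrightarrow> (x, v) \<in> E\<^sup>*" for x
      using that symE by (meson rtrancl.rtrancl_into_rtrancl symD)
    then show ?thesis by (simp add: rt_def)
  qed
  have step: "\<exists>u. (u, v) \<in> E \<and> dist u < dist v" if "rt v \<noteq> v" for v
  proof -
    from rt_reach obtain n where "(rt v, v) \<in> E ^^ n" by (metis rtrancl_imp_relpow)
    then have d: "(rt v, v) \<in> E ^^ dist v" unfolding dist_def by (rule LeastI)
    with that obtain k where k: "dist v = Suc k" by (cases "dist v") auto
    with d obtain u where u: "(rt v, u) \<in> E ^^ k" "(u, v) \<in> E" by auto
    then have "dist u \<le> k" using rt_eq[OF u(2)] by (auto simp: dist_def intro: Least_le)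
    with u k show ?thesis by auto
  qed
  define par where "par v = (if v < t \<and> rt v \<noteq> v then SOME u. (u, v) \<in> E \<and> dist u < dist v else t)" for v
  define rank where "rank v = (if v < t then Suc (dist v) else 0)" for v
  have par: "(par v, v) \<in> E" "dist (par v) < dist v" if "v < t" "rt v \<noteq> v" for v
    using someI_ex[OF step[OF that(2)]] that by (simp_all add: par_def)
  have par_less: "v < t \<Longrightarrow> par v < t \<longleftrightarrow> rt v \<noteq> v" for v
    using par[of v] by (auto simp: E_def par_def)
  have rank_less: "v < t \<Longrightarrow> rank (par v) < rank v" for v
    using par(2)[of v] par_less[of v] by (auto simp: rank_def)
  have rooted: "rooted_tree {..t} t par rank"
  proof
    show "par v \<in> {..t}" if "v \<in> {..t}" for v
      using par[of v] by (auto simp: par_def E_def)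
  qed (use rank_less in \<open>auto simp: par_def\<close>)
  then interpret rooted_tree "{..t}" t par rank .
  have edge: "0 < a {v, par v}" if "v < t" "par v < t" for v
    using par[of v] par_less[of v] that by (simp add: E_def insert_commute)
  have zero: "cut_size a t (desc {..t} par z) = 0" if z: "z < t" "par z = t" for z
  proof -
    have rtz: "rt z = z" using par_less[of z] z by auto
    have t_notin: "t \<notin> desc {..t} par z"
      using rank_desc[of t z] z by (auto simp: rank_def)
    \<comment> \<open>\<open>fwd\<close> and \<open>bwd\<close> together identify the subtree of
      \<open>z\<close> with its component.\<close>
    have fwd: "rt x = z" if "x \<in> desc {..t} par z" for x
      using that
    proof (induction "rank x" arbitrary: x rule: less_induct)
      case less
      show ?case
      proof (cases "x = z")
        case False
        have x: "x < t" using less.prems t_notin desc_subset by (cases "x = t") fastforce+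
        have up: "par x \<in> desc {..t} par z" using less.prems False by (rule desc_up)
        then have "par x < t" using t_notin desc_subset by (cases "par x = t") fastforce+
        then have "rt x = rt (par x)" using par(1)[of x] par_less[of x] x rt_eq by auto
        then show ?thesis using less.hyps[OF rank_less[OF x] up] by simp
      qed (simp add: rtz)
    qed
    have bwd: "x \<in> desc {..t} par z" if "x < t" "rt x = z" for x
      using that
    proof (induction "rank x" arbitrary: x rule: less_induct)
      case less
      show ?case
      proof (cases "x = z")
        case False
        then have "par x < t" "rt (par x) = z" using par(1)[of x] par_less[of x] less.prems rt_eq by auto
        then show ?thesis using less.hyps[OF rank_less] less.prems desc_down by simp
      qed (simp add: self_in_desc z less_imp_le)
    qed
    have "a {u, v} = 0" if u: "u \<in> desc {..t} par z" and v: "v \<in> {..<t} - desc {..t} par z" for u v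
    proof (rule ccontr)
      assume "a {u, v} \<noteq> 0"
      moreover have "u < t" using u t_notin desc_subset by (cases "u = t") fastforce+
      ultimately have "(u, v) \<in> E" using v by (simp add: E_def)
      then have "rt v = z" using fwd[OF u] rt_eq by simp
      then show False using bwd[of v] v by blast
    qed
    then show ?thesis by (simp add: cut_size_def)
  qed
  show ?thesis using rooted edge zero by blast
qed

text \<open>
  Splitting off a new vertex with \<open>J v\<close> edges to \<open>v\<close> keeps every cut at size two or more exactly
  under the inequality below, and it suffices that \<open>J\<close> is balanced on the subtrees of a spanning
  forest: the sets with at most one leaving edge are assembled from them.
\<close>

lemma balanced_split:
  fixes a :: "nat set \<Rightarrow> nat" and J df :: "nat \<Rightarrow> nat"
  assumes tree: "rooted_tree {..t} t par rank"
    and edge: "\<And>v. v < t \<Longrightarrow> par v < t \<Longrightarrow> 0 < a {v, par v}"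
    and root_cut: "\<And>z. z < t \<Longrightarrow> par z = t \<Longrightarrow> cut_size a t (desc {..t} par z) = 0"
    and cuts: "\<And>X. X \<subseteq> {..<t} \<Longrightarrow> X \<noteq> {} \<Longrightarrow> 2 \<le> cut_size a t X + sum df X"
    and J_le: "\<And>v. v < t \<Longrightarrow> J v \<le> df v"
    and upper: "\<And>v. v < t \<Longrightarrow> p * sum J (desc {..t} par v) < sum df (desc {..t} par v) + p"
    and lower: "\<And>v. v < t \<Longrightarrow> sum df (desc {..t} par v) < p * sum J (desc {..t} par v) + p"
    and total: "sum J {..<t} \<le> r" and p: "2 \<le> p" and r: "3 \<le> r" and X: "X \<subseteq> {..<t}"
  shows "2 * sum J X + 2 \<le> cut_size a t X + sum df X + r"
proof -
  interpret rooted_tree "{..t}" t par rank by (rule tree)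
  let ?D = "desc {..t} par"
  have t_notin: "t \<notin> ?D v" if "v < t" for v
  proof
    assume "t \<in> ?D v"
    then have "rank v \<le> rank t" "v \<in> ?D t" using rank_desc desc_root that by auto
    moreover have "rank t < rank v" if "v < t" for v
      using that
    proof (induction "rank v" arbitrary: v rule: less_induct)
      case less
      have "rank (par v) < rank v" "par v \<le> t" using rank_par[of v] par_in[of v] less.prems by auto
      with less show ?case by (cases "par v = t") fastforce+
    qed
    ultimately show False using that by fastforce
  qed
  have D_sub: "?D v \<subseteq> {..<t}" if "v < t" for v
  proof -
    have "?D v \<subseteq> {..t} - {t}" using t_notin[OF that] desc_subset[of v] by blast
    also have "\<dots> \<subseteq> {..<t}" by auto
    finally show ?thesis .
  qed
  have finX: "finite X" using X finite_subset by blast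
  have root_ex: "\<exists>z<t. par z = t \<and> v \<in> ?D z" if "v < t" for v
    using that
  proof (induction "rank v" arbitrary: v rule: less_induct)
    case less
    show ?case
    proof (cases "par v = t")
      case True
      then show ?thesis using self_in_desc less.prems by auto
    next
      case False
      then have "par v < t" using par_in[of v] less.prems by auto
      then show ?thesis using less.hyps[of "par v"] rank_par[of v] less.prems desc_down[of v] by fastforce
    qed
  qed
  \<comment> \<open>As \<open>p\<close> is at least two, a subtree gives away at most half of its
    deficit, rounded up.\<close>
  have half: "2 * sum J (?D v) \<le> sum df (?D v) + 1" if "v < t" for v
  proof (cases "sum J (?D v)")
    case (Suc j)
    have "2 * j \<le> p * j" using p by (rule mult_right_mono) simp
    moreover have "p * j < sum df (?D v)" using upper[OF that] unfolding Suc by simp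
    ultimately show ?thesis unfolding Suc mult_Suc_right by linarith
  qed simp
  \<comment> \<open>The slack, deficit minus \<open>J\<close>, is monotone in the set; written
    without subtraction. Since \<open>sum J X\<close> is at most \<open>r\<close> and at most
    \<open>sum df X\<close>, the goal only asks for two more units, from the cut or from
    slack.\<close>
  have gap: "sum J Z + sum df Y \<le> sum df Z + sum J Y" if "Y \<subseteq> Z" "Z \<subseteq> {..<t}" for Y Z
  proof -
    have "finite Z" using that(2) finite_subset by blast
    then have "sum g Z = sum g (Z - Y) + sum g Y" for g :: "nat \<Rightarrow> nat"
      using that(1) by (metis sum.subset_diff)
    moreover have "sum J (Z - Y) \<le> sum df (Z - Y)" using J_le that(2) by (intro sum_mono) auto
    ultimately show ?thesis by simp
  qed
  have le: "sum J X \<le> sum df X" using gap[of "{}" X] X by simp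
  have le_r: "sum J X \<le> r" using total sum_mono2[of "{..<t}" X J] X by simp
  \<comment> \<open>No edge leaves a component, so its deficit is at least two, and halving leaves
    one unit of slack.\<close>
  have full: "sum J (?D z) + 1 \<le> sum df (?D z)" if "z < t" "par z = t" for z
  proof -
    have "?D z \<noteq> {}" using self_in_desc[of z] that by auto
    then have "2 \<le> sum df (?D z)" using cuts[OF D_sub] root_cut that by fastforce
    then show ?thesis using half[OF that(1)] by linarith
  qed
  \<comment> \<open>The forest edges across the boundary of \<open>X\<close>, each named by its
    lower end.\<close>
  define K where "K = {v. v < t \<and> par v < t \<and> (v \<in> X) \<noteq> (par v \<in> X)}"
  have K_le: "card K \<le> cut_size a t X"
  proof -
    \<comment> \<open>Orients a crossing edge out of \<open>X\<close>. This is injective because two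
      vertices cannot be parents of each other.\<close>
    define pr where "pr v = (if v \<in> X then (v, par v) else (par v, v))" for v
    have "inj_on pr K"
    proof (rule inj_onI)
      fix v v' assume v: "v \<in> K" "v' \<in> K" "pr v = pr v'"
      then consider "v = v'" | "v = par v'" "v' = par v" unfolding pr_def by (metis prod.inject)
      then show "v = v'"
      proof cases
        case 2
        have "rank (par v) < rank v" "rank (par v') < rank v'"
          using v rank_par by (auto simp: K_def)
        then show ?thesis unfolding 2[symmetric] by linarith
      qed
    qed
    then have "card K = card (pr ` K)" by (simp add: card_image)
    also have "\<dots> \<le> (\<Sum>(u, v)\<in>pr ` K. a {u, v})"
    proof -
      have "1 \<le> (case q of (u, v) \<Rightarrow> a {u, v})" if "q \<in> pr ` K" for q
        using that edge by (force simp: pr_def K_def insert_commute Suc_le_eq)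
      then have "(\<Sum>q\<in>pr ` K. 1) \<le> (\<Sum>(u, v)\<in>pr ` K. a {u, v})" by (intro sum_mono)
      then show ?thesis by simp
    qed
    also have "\<dots> \<le> (\<Sum>(u, v)\<in>X \<times> ({..<t} - X). a {u, v})"
      using finX by (intro sum_mono2) (auto simp: pr_def K_def split: if_splits)
    also have "\<dots> = cut_size a t X" by (simp add: cut_size_def sum.cartesian_product)
    finally show ?thesis .
  qed
  have finK: "finite K" by (simp add: K_def)
  \<comment> \<open>A subtree without crossing edges lies on one side. The edge above
    \<open>y\<close> is outside the subtree, hence the exception.\<close>
  have uniform: "x \<in> X \<longleftrightarrow> y \<in> X" if "y < t" "?D y \<inter> K \<subseteq> {y}" "x \<in> ?D y" for x y
    using that(3)
  proof (induction "rank x" arbitrary: x rule: less_induct)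
    case less
    show ?case
    proof (cases "x = y")
      case False
      have x: "x < t" using less.prems D_sub that(1) by blast
      have up: "par x \<in> ?D y" using less.prems False by (rule desc_up)
      then have "par x < t" using D_sub that(1) by blast
      then have "x \<in> X \<longleftrightarrow> par x \<in> X" using that(2) less.prems x False by (auto simp: K_def)
      then show ?thesis using less.hyps[OF _ up] rank_par[of x] x by simp
    qed simp
  qed
  have roots_disjoint: "?D z \<inter> ?D z' = {}" if "z < t" "z' < t" "par z = t" "par z' = t" "z \<noteq> z'" for z z'
    using desc_children_disjoint[of z t z'] that by (simp add: children_def)
  consider "2 \<le> cut_size a t X" | "cut_size a t X = 0" | "cut_size a t X = 1" by linarith
  then show ?thesis
  proof cases
    case 1
    then show ?thesis using le le_r by linarith
  next
    case 2
    then have K0: "K = {}" using K_le finK by simp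
    have comp: "?D z \<subseteq> X" if "z < t" "v \<in> X" "v \<in> ?D z" for z v
      using uniform[of z] that K0 by blast
    show ?thesis
    proof (cases "X = {}")
      case False
      then obtain v where v: "v \<in> X" by blast
      then obtain z where z: "z < t" "par z = t" "v \<in> ?D z" using root_ex X by blast
      have zX: "?D z \<subseteq> X" using comp z v by blast
      show ?thesis
      proof (cases "X = ?D z")
        case True
        then show ?thesis using half[OF z(1), folded True] r by linarith
      next
        case False
        with zX obtain v' where v': "v' \<in> X" "v' \<notin> ?D z" by blast
        then obtain z' where z': "z' < t" "par z' = t" "v' \<in> ?D z'" using root_ex X by blast
        have "?D z' \<subseteq> X" using comp z' v' by blast
        \<comment> \<open>Two whole components contribute one unit of slack each.\<close>
        moreover have "?D z \<inter> ?D z' = {}" using roots_disjoint z z' v' by blast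
        ultimately have "sum J X + (sum df (?D z) + sum df (?D z')) \<le> sum df X + (sum J (?D z) + sum J (?D z'))"
          using gap[of "?D z \<union> ?D z'" X] zX X by (simp add: sum.union_disjoint)
        then show ?thesis using full[of z] full[of z'] z z' le_r by linarith
      qed
    qed (use r in simp)
  next
    case 3
    show ?thesis
    proof (cases "\<exists>z<t. par z = t \<and> ?D z \<subseteq> X")
      case True
      then obtain z where "z < t" "par z = t" "?D z \<subseteq> X" by blast
      then show ?thesis using full[of z] gap[of "?D z" X] X 3 le_r by linarith
    next
      case no_full: False
      have K1: "K \<subseteq> {y}" if "y \<in> K" for y
        using that K_le 3 finK card_le_Suc0_iff_eq by auto
      have "X \<noteq> {}" using 3 by (auto simp: cut_size_def)
      then obtain v where v: "v \<in> X" by blast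
      then obtain z where z: "z < t" "par z = t" "v \<in> ?D z" using root_ex X by blast
      have "\<exists>y. y \<in> ?D z \<inter> K"
        using uniform[OF z(1)] z v no_full by blast
      \<comment> \<open>\<open>y\<close> is the only crossing forest edge, so \<open>X\<close> lies
        in the component of \<open>z\<close> and is either the subtree of \<open>y\<close> or the
        rest of that component.\<close>
      then obtain y where y: "y \<in> ?D z" "y \<in> K" by blast
      have yt: "y < t" "par y < t" "(y \<in> X) \<noteq> (par y \<in> X)" using y by (auto simp: K_def)
      have yz: "y \<noteq> z" using yt z by auto
      have XD: "X \<subseteq> ?D z"
      proof
        fix v' assume v': "v' \<in> X"
        then obtain z' where z': "z' < t" "par z' = t" "v' \<in> ?D z'" using root_ex X by blast
        show "v' \<in> ?D z"
        proof (rule ccontr)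
          assume "v' \<notin> ?D z"
          then have "y \<notin> ?D z'" using roots_disjoint[of z z'] z z' y by blast
          then have "?D z' \<subseteq> X" using uniform[OF z'(1)] K1[OF y(2)] z' v' by blast
          then show False using no_full z' by blast
        qed
      qed
      have in_y: "x \<in> X \<longleftrightarrow> y \<in> X" if "x \<in> ?D y" for x
        using uniform[OF yt(1) _ that] K1[OF y(2)] by blast
      have out_y: "x \<in> X \<longleftrightarrow> z \<in> X" if "x \<in> ?D z - ?D y" for x
        using that
      proof (induction "rank x" arbitrary: x rule: less_induct)
        case less
        show ?case
        proof (cases "x = z")
          case False
          have x: "x < t" "x \<noteq> y" using less.prems D_sub[OF z(1)] self_in_desc[of y] yt by auto
          have up: "par x \<in> ?D z - ?D y" using less.prems False desc_up desc_down[of x] x by auto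
          then have "par x < t" using D_sub[OF z(1)] by blast
          then have "x \<in> X \<longleftrightarrow> par x \<in> X" using K1[OF y(2)] x by (auto simp: K_def)
          then show ?thesis using less.hyps[OF _ up] rank_par[of x] x by simp
        qed simp
      qed
      have "par y \<notin> ?D y" using rank_desc[of "par y" y] rank_par[of y] yt by auto
      then have pz: "par y \<in> X \<longleftrightarrow> z \<in> X" using out_y desc_up[OF y(1) yz] by blast
      have yzD: "?D y \<subseteq> ?D z"
      proof
        fix x assume "x \<in> ?D y"
        then show "x \<in> ?D z"
        proof (induction "rank x" arbitrary: x rule: less_induct)
          case less
          show ?case
          proof (cases "x = y")
            case False
            have "x < t" using less.prems D_sub[OF yt(1)] by blast
            then show ?thesis
              using less.hyps[OF _ desc_up[OF less.prems False]] rank_par[of x] desc_down[of x] by simp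
          qed (simp add: y)
        qed
      qed
      show ?thesis
      proof (cases "y \<in> X")
        case True
        then have "X = ?D y" using in_y out_y pz yt XD by blast
        then show ?thesis using half[OF yt(1)] r 3 by simp
      next
        case False
        then have "X = ?D z - ?D y" using in_y out_y pz yt XD by blast
        then have split: "sum g (?D z) = sum g X + sum g (?D y)" for g :: "nat \<Rightarrow> nat"
          using yzD by (simp add: sum.subset_diff)
        have Jz: "sum J X + sum J (?D y) \<le> r"
          using total sum_mono2[of "{..<t}" "?D z" J] D_sub[OF z(1)] split[of J] by simp
        show ?thesis
        proof (rule ccontr)
          assume "\<not> ?thesis"
          \<comment> \<open>A violation forces equality throughout, so nothing is taken below
            \<open>y\<close>. Then \<open>lower\<close> at \<open>y\<close> and \<open>upper\<close>
            at \<open>z\<close> give \<open>(p - 1) * (r - 2) < 1\<close>, against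
            \<open>p \<ge> 2\<close> and \<open>r \<ge> 3\<close>.\<close>
          then have eq: "sum J X = r" "sum df X = r" using le le_r 3 by linarith+
          then have y0: "sum J (?D y) = 0" using Jz by simp
          then have "sum df (?D y) < p" using lower[OF yt(1)] by simp
          moreover have "p * r < r + sum df (?D y) + p" using upper[OF z(1)] split eq y0 by simp
          ultimately have lt: "p * r + 1 < r + 2 * p" by linarith
          obtain q s where "p = 2 + q" "r = 3 + s" using p r le_Suc_ex by metis
          with lt show False by (simp add: algebra_simps)
        qed
      qed
    qed
  qed
qed

section \<open>Splitting off the vertices\<close>

definition pairs :: "nat \<Rightarrow> nat set set" where
  "pairs n = {e. e \<subseteq> {..<n} \<and> card e = 2}"

definition mdeg :: "(nat set \<Rightarrow> nat) \<Rightarrow> nat \<Rightarrow> nat \<Rightarrow> nat" where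
  "mdeg a t v = (\<Sum>u\<in>{..<t} - {v}. a {v, u})"

lemma finite_pairs [simp]: "finite (pairs n)"
  by (rule finite_subset[of _ "Pow {..<n}"]) (auto simp: pairs_def)

lemma doubleton_in_pairs: "{u, v} \<in> pairs n \<longleftrightarrow> u < n \<and> v < n \<and> u \<noteq> v"
  by (auto simp: pairs_def card_2_iff doubleton_eq_iff)

lemma pairsE:
  assumes "e \<in> pairs n"
  obtains u v where "e = {u, v}" "u < n" "v < n" "u \<noteq> v"
  using assms by (auto simp: pairs_def card_2_iff)

lemma sum_pairs_at:
  assumes "v < n"
  shows "(\<Sum>e | e \<in> pairs n \<and> v \<in> e. f e) = (\<Sum>u\<in>{..<n} - {v}. f {v, u})"
proof (rule sum.reindex_bij_betw[symmetric, of "\<lambda>u. {v, u}"])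
  show "bij_betw (\<lambda>u. {v, u}) ({..<n} - {v}) {e \<in> pairs n. v \<in> e}"
  proof (rule bij_betw_imageI)
    show "inj_on (\<lambda>u. {v, u}) ({..<n} - {v})" by (auto simp: inj_on_def doubleton_eq_iff)
    show "(\<lambda>u. {v, u}) ` ({..<n} - {v}) = {e \<in> pairs n. v \<in> e}"
      using assms by (auto simp: doubleton_in_pairs elim!: pairsE)
  qed
qed

lemma mdeg_pairs: "v < n \<Longrightarrow> mdeg a n v = (\<Sum>e | e \<in> pairs n \<and> v \<in> e. a e)"
  by (simp add: mdeg_def sum_pairs_at)

lemma handshake: "(\<Sum>v<n. mdeg a n v) = 2 * (\<Sum>e\<in>pairs n. a e)"
proof -
  have "(\<Sum>v<n. mdeg a n v) = (\<Sum>v<n. \<Sum>e | e \<in> pairs n \<and> v \<in> e. a e)"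
    by (simp add: mdeg_pairs)
  also have "\<dots> = (\<Sum>e\<in>pairs n. \<Sum>v | v \<in> {..<n} \<and> v \<in> e. a e)"
    by (rule sum.swap_restrict) auto
  also have "\<dots> = (\<Sum>e\<in>pairs n. 2 * a e)"
  proof (rule sum.cong)
    fix e assume "e \<in> pairs n"
    then have "{v. v \<in> {..<n} \<and> v \<in> e} = e" "card e = 2" by (auto simp: pairs_def)
    then show "(\<Sum>v | v \<in> {..<n} \<and> v \<in> e. a e) = 2 * a e" by simp
  qed simp
  finally show ?thesis by (simp add: sum_distrib_left)
qed

text \<open>The vertex \<open>t\<close> is larger than all old ones, so \<open>Min e\<close> reads
  off the other end of an edge at \<open>t\<close>.\<close>

definition attach :: "(nat set \<Rightarrow> nat) \<Rightarrow> nat \<Rightarrow> (nat \<Rightarrow> nat) \<Rightarrow> nat set \<Rightarrow> nat" where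
  "attach a t J e = (if t \<in> e then J (Min e) else a e)"

lemma attach_new: "u < t \<Longrightarrow> attach a t J {u, t} = J u" "u < t \<Longrightarrow> attach a t J {t, u} = J u"
  by (auto simp: attach_def min_def)

lemma attach_old: "u < t \<Longrightarrow> v < t \<Longrightarrow> attach a t J {u, v} = a {u, v}"
  by (auto simp: attach_def)

lemma attach_pairs: "e \<in> pairs t \<Longrightarrow> attach a t J e = a e"
  by (auto simp: attach_def pairs_def)

lemma pairs_SucE:
  assumes "e \<in> pairs (Suc t)"
  obtains "e \<in> pairs t" | u where "u < t" "e = {u, t}"
  using assms
proof (rule pairsE)
  fix u v assume e: "e = {u, v}" "u < Suc t" "v < Suc t" "u \<noteq> v"
  then consider "u < t" "v < t" | "u = t" "v < t" | "u < t" "v = t" by linarith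
  then show ?thesis
    using that e by cases (auto simp: doubleton_in_pairs insert_commute)
qed

lemma mdeg_attach: "v < t \<Longrightarrow> mdeg (attach a t J) (Suc t) v = mdeg a t v + J v"
proof -
  assume v: "v < t"
  then have "{..<Suc t} - {v} = insert t ({..<t} - {v})" by auto
  then have "mdeg (attach a t J) (Suc t) v = attach a t J {v, t} + (\<Sum>u\<in>{..<t} - {v}. attach a t J {v, u})"
    by (simp add: mdeg_def)
  also have "\<dots> = J v + mdeg a t v"
    using v by (auto simp: mdeg_def attach_new attach_old intro!: sum.cong)
  finally show ?thesis by simp
qed

lemma mdeg_attach_new: "mdeg (attach a t J) (Suc t) t = sum J {..<t}"
proof -
  have "{..<Suc t} - {t} = {..<t}" by auto
  then show ?thesis by (simp add: mdeg_def attach_new)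
qed

lemma cut_attach:
  assumes "X \<subseteq> {..<t}"
  shows "cut_size (attach a t J) (Suc t) X = cut_size a t X + sum J X"
proof -
  have "{..<Suc t} - X = insert t ({..<t} - X)" using assms by auto
  then have "cut_size (attach a t J) (Suc t) X
      = (\<Sum>u\<in>X. attach a t J {u, t} + (\<Sum>v\<in>{..<t} - X. attach a t J {u, v}))"
    by (simp add: cut_size_def)
  also have "\<dots> = (\<Sum>u\<in>X. J u + (\<Sum>v\<in>{..<t} - X. a {u, v}))"
    using assms by (intro sum.cong arg_cong2[of _ _ _ _ "(+)"]) (auto simp: attach_new attach_old subset_iff)
  finally show ?thesis by (simp add: cut_size_def sum.distrib)
qed

lemma cut_attach_new:
  assumes "X \<subseteq> {..<t}"
  shows "cut_size (attach a t J) (Suc t) (insert t X) = cut_size a t X + sum J ({..<t} - X)"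
proof -
  have fin: "finite X" using assms finite_subset by blast
  have t: "t \<notin> X" using assms by auto
  have "{..<Suc t} - insert t X = {..<t} - X" by auto
  then have "cut_size (attach a t J) (Suc t) (insert t X)
      = (\<Sum>v\<in>{..<t} - X. attach a t J {t, v}) + (\<Sum>u\<in>X. \<Sum>v\<in>{..<t} - X. attach a t J {u, v})"
    using fin t by (simp add: cut_size_def)
  also have "\<dots> = sum J ({..<t} - X) + cut_size a t X"
    unfolding cut_size_def using assms
    by (intro arg_cong2[of _ _ _ _ "(+)"] sum.cong) (auto simp: attach_new attach_old subset_iff)
  finally show ?thesis by simp
qed

lemma cut_complement: "X \<subseteq> {..<t} \<Longrightarrow> cut_size a t ({..<t} - X) = cut_size a t X"
  unfolding cut_size_def by (subst sum.swap) (simp add: double_diff insert_commute)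

text \<open>
  The color multiplicities \<open>a i\<close> on \<open>t\<close> vertices come from amalgamating the \<open>m - t\<close> remaining
  vertices of a 2-edge-connected factorization into one: then \<open>r - mdeg (a i) t v\<close> edges join \<open>v\<close> to the
  amalgamated vertex, the degree sum bound says that the number of loops there is nonnegative, and
  the last condition is 2-edge-connectedness.
\<close>

definition extendable :: "nat \<Rightarrow> nat \<Rightarrow> nat \<Rightarrow> nat \<Rightarrow> nat \<Rightarrow> (nat \<Rightarrow> nat set \<Rightarrow> nat) \<Rightarrow> bool" where
  "extendable \<mu> r k m t a \<longleftrightarrow>
     (\<forall>e\<in>pairs t. (\<Sum>i\<in>{1..k}. a i e) = \<mu>) \<and>
     (\<forall>i\<in>{1..k}. (\<forall>v<t. mdeg (a i) t v \<le> r) \<and> r * t \<le> r * (m - t) + (\<Sum>v<t. mdeg (a i) t v) \<and>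
       (\<forall>X\<subseteq>{..<t}. X \<noteq> {} \<longrightarrow> 2 \<le> cut_size (a i) t X + (\<Sum>v\<in>X. r - mdeg (a i) t v)))"

lemma extendableD:
  assumes "extendable \<mu> r k m t a" and "i \<in> {1..k}"
  shows "v < t \<Longrightarrow> mdeg (a i) t v \<le> r"
    and "r * t \<le> r * (m - t) + (\<Sum>v<t. mdeg (a i) t v)"
    and "X \<subseteq> {..<t} \<Longrightarrow> X \<noteq> {} \<Longrightarrow> 2 \<le> cut_size (a i) t X + (\<Sum>v\<in>X. r - mdeg (a i) t v)"
  using assms unfolding extendable_def by blast+

text \<open>In the final graph \<open>v\<close> has \<open>r * k = \<mu> * (m - 1)\<close> edges
  over all colors, of which \<open>\<mu> * (t - 1)\<close> go to the vertices already
  present.\<close>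

lemma extendable_deficit_sum:
  assumes ext: "extendable \<mu> r k m t a" and rk: "r * k = \<mu> * (m - 1)" and v: "v < t" and "t \<le> m"
  shows "(\<Sum>i\<in>{1..k}. r - mdeg (a i) t v) = \<mu> * (m - t)"
proof -
  have "(\<Sum>i\<in>{1..k}. mdeg (a i) t v) = (\<Sum>u\<in>{..<t} - {v}. \<Sum>i\<in>{1..k}. a i {v, u})"
    unfolding mdeg_def by (rule sum.swap)
  also have "\<dots> = (\<Sum>u\<in>{..<t} - {v}. \<mu>)"
    using ext v by (intro sum.cong) (auto simp: extendable_def doubleton_in_pairs)
  finally have mdeg: "(\<Sum>i\<in>{1..k}. mdeg (a i) t v) = \<mu> * (t - 1)" using v by simp
  have "(\<Sum>i\<in>{1..k}. r - mdeg (a i) t v) + (\<Sum>i\<in>{1..k}. mdeg (a i) t v) = (\<Sum>i\<in>{1..k}. r)"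
    unfolding sum.distrib[symmetric] using extendableD(1)[OF ext _ v] by (intro sum.cong) auto
  then have "(\<Sum>i\<in>{1..k}. r - mdeg (a i) t v) + \<mu> * (t - 1) = \<mu> * (m - 1)"
    using mdeg rk by (simp add: mult.commute)
  moreover have "m - 1 = (m - t) + (t - 1)" using assms by simp
  then have "\<mu> * (m - 1) = \<mu> * (m - t) + \<mu> * (t - 1)" by (simp only: distrib_left)
  ultimately show ?thesis by linarith
qed

lemma rounds_of_nat: "rounds z (real n) \<Longrightarrow> z = int n"
  by (simp add: rounds_def)

lemma rounds_div:
  assumes "rounds (int z) (real c / real p)" and "0 < p"
  shows "p * z < c + p" and "c < p * z + p"
proof -
  have "real_of_int (int z) < real c / real p + 1" "real c / real p < real_of_int (int z) + 1"
    using assms(1) unfolding rounds_def by linarith+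
  then have "real (p * z) < real (c + p)" "real c < real (p * z + p)"
    using assms(2) by (simp_all add: field_simps)
  then show "p * z < c + p" and "c < p * z + p" by linarith+
qed

text \<open>One split of the amalgamated vertex, which stands for \<open>p = m - t\<close> vertices.
  The number \<open>t\<close> names the amalgamated vertex before the split and the new vertex after
  it.\<close>

lemma extend_one:
  assumes ext: "extendable \<mu> r k m t a" and rk: "r * k = \<mu> * (m - 1)" and ev: "even (r * m)"
    and r: "3 \<le> r" and tm: "t + 2 \<le> m"
  shows "\<exists>b. extendable \<mu> r k m (Suc t) b \<and> (\<forall>i\<in>{1..k}. \<forall>e\<in>pairs t. b i e = a i e)"
proof -
  define p where "p = m - t"
  have p: "2 \<le> p" "m = t + p" "m - Suc t = p - 1" using tm by (auto simp: p_def)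
  define df where "df i v = r - mdeg (a i) t v" for i v
  \<comment> \<open>The ends at the amalgamated vertex: \<open>c i v\<close> edges from an old
    \<open>v\<close>, and \<open>c i t\<close> ends of loops, which is twice the number of loops. In
    each color they add up to \<open>r * p\<close>.\<close>
  define c where "c i v = (if v < t then df i v else r * p - (\<Sum>v<t. df i v))" for i v
  have dg_le: "mdeg (a i) t v \<le> r" if "i \<in> {1..k}" "v < t" for i v
    by (rule extendableD(1)[OF ext that])
  have sum_df: "(\<Sum>v<t. df i v) + (\<Sum>v<t. mdeg (a i) t v) = r * t" if "i \<in> {1..k}" for i
    unfolding df_def sum.distrib[symmetric] using dg_le[OF that] by (simp add: mult.commute)
  have df_le: "(\<Sum>v<t. df i v) \<le> r * p" if "i \<in> {1..k}" for i
    using extendableD(2)[OF ext that] sum_df[OF that] by (simp add: p_def)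
  have c_root: "c i t + (\<Sum>v<t. df i v) = r * p" "even (c i t)" if "i \<in> {1..k}" for i
  proof -
    show 1: "c i t + (\<Sum>v<t. df i v) = r * p" using df_le[OF that] by (simp add: c_def)
    have "even (\<Sum>v<t. mdeg (a i) t v)" by (simp add: handshake)
    moreover have "even (r * t + r * p)" using ev p by (simp add: algebra_simps)
    ultimately show "even (c i t)" using 1 sum_df[OF that] by (metis even_add)
  qed
  have sum_c: "sum (c i) {..t} = r * p" if "i \<in> {1..k}" for i
  proof -
    have "sum (c i) {..t} = c i t + sum (c i) {..<t}"
      unfolding lessThan_Suc_atMost[symmetric] by simp
    then show ?thesis using c_root(1)[OF that] by (simp add: c_def)
  qed
  obtain par rank where tree: "\<And>i. rooted_tree {..t} t (par i) (rank i)"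
    and edge: "\<And>i v. v < t \<Longrightarrow> par i v < t \<Longrightarrow> 0 < a i {v, par i v}"
    and root: "\<And>i z. z < t \<Longrightarrow> par i z = t \<Longrightarrow> cut_size (a i) t (desc {..t} (par i) z) = 0"
    using spanning_forest[of t "a _"] by metis
  have "\<exists>y. (\<forall>v\<in>{..t}. rounds (\<Sum>i\<in>{1..k}. y i v) (\<Sum>i\<in>{1..k}. real (c i v) / real p)) \<and>
    (\<forall>i\<in>{1..k}. \<forall>v\<in>{..t}. rounds (y i v) (real (c i v) / real p) \<and>
      rounds (sum (y i) (desc {..t} (par i) v)) (\<Sum>v\<in>desc {..t} (par i) v. real (c i v) / real p))"
    by (rule simultaneous_tree_rounding[OF _ _ tree]) auto
  then obtain y where
    y: "\<forall>v\<in>{..t}. rounds (\<Sum>i\<in>{1..k}. y i v) (\<Sum>i\<in>{1..k}. real (c i v) / real p)"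
      "\<forall>i\<in>{1..k}. \<forall>v\<in>{..t}. rounds (y i v) (real (c i v) / real p) \<and>
        rounds (sum (y i) (desc {..t} (par i) v)) (\<Sum>v\<in>desc {..t} (par i) v. real (c i v) / real p)"
    by blast
  have y_col: "rounds (\<Sum>i\<in>{1..k}. y i v) (\<Sum>i\<in>{1..k}. real (c i v) / real p)" if "v \<le> t" for v
    using y(1) that by (meson atMost_iff)
  have y_elem: "rounds (y i v) (real (c i v) / real p)"
    and y_sub: "rounds (sum (y i) (desc {..t} (par i) v)) (\<Sum>v\<in>desc {..t} (par i) v. real (c i v) / real p)"
    if "i \<in> {1..k}" "v \<le> t" for i v
    using y(2) that by (meson atMost_iff)+
  define J where "J i v = nat (y i v)" for i v
  have int_J: "int (J i v) = y i v" if "i \<in> {1..k}" "v \<le> t" for i v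
  proof -
    have "0 \<le> \<lfloor>real (c i v) / real p\<rfloor>" by simp
    then show ?thesis using y_elem[OF that] unfolding J_def rounds_def by linarith
  qed
  \<comment> \<open>The ideal total is \<open>\<mu> * p / p\<close>, an integer, so the rounding is
    exact.\<close>
  have J_col: "(\<Sum>i\<in>{1..k}. J i v) = \<mu>" if "v < t" for v
  proof -
    have "(\<Sum>i\<in>{1..k}. real (c i v) / real p) = real (\<Sum>i\<in>{1..k}. c i v) / real p"
      by (simp add: sum_divide_distrib)
    also have "(\<Sum>i\<in>{1..k}. c i v) = \<mu> * p"
      using extendable_deficit_sum[OF ext rk that] that tm by (simp add: c_def df_def p_def)
    finally have "(\<Sum>i\<in>{1..k}. real (c i v) / real p) = real \<mu>" using p(1) by simp
    then have "(\<Sum>i\<in>{1..k}. y i v) = int \<mu>" using y_col[of v] that rounds_of_nat by auto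
    then have "int (\<Sum>i\<in>{1..k}. J i v) = int \<mu>" using int_J that by simp
    then show ?thesis by linarith
  qed
  have J_sub: "p * sum (J i) (desc {..t} (par i) v) < sum (c i) (desc {..t} (par i) v) + p"
      "sum (c i) (desc {..t} (par i) v) < p * sum (J i) (desc {..t} (par i) v) + p"
    if "i \<in> {1..k}" "v \<le> t" for i v
  proof -
    have "sum (y i) (desc {..t} (par i) v) = int (sum (J i) (desc {..t} (par i) v))"
      using int_J[OF that(1)] by (simp add: desc_def)
    then have "rounds (int (sum (J i) (desc {..t} (par i) v)))
        (real (sum (c i) (desc {..t} (par i) v)) / real p)"
      using y_sub[OF that] by (simp add: sum_divide_distrib)
    then show "p * sum (J i) (desc {..t} (par i) v) < sum (c i) (desc {..t} (par i) v) + p"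
      "sum (c i) (desc {..t} (par i) v) < p * sum (J i) (desc {..t} (par i) v) + p"
      using rounds_div p(1) by auto
  qed
  have J_elem: "p * J i v < c i v + p" if "i \<in> {1..k}" "v \<le> t" for i v
    using rounds_div[of "J i v" "c i v" p] y_elem[OF that] int_J[OF that] p(1) by simp
  \<comment> \<open>The subtree of the root is everything, and its ideal share
    \<open>r * p / p\<close> is an integer: the new vertex gets degree exactly
    \<open>r\<close>.\<close>
  have J_row: "sum (J i) {..<t} + J i t = r" if "i \<in> {1..k}" for i
  proof -
    have "desc {..t} (par i) t = {..t}" using rooted_tree.desc_root[OF tree] .
    then have "p * sum (J i) {..t} < r * p + p" "r * p < p * sum (J i) {..t} + p"
      using J_sub[OF that, of t] sum_c[OF that] by auto
    then have "p * sum (J i) {..t} < p * (r + 1)" "p * r < p * (sum (J i) {..t} + 1)"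
      by (simp_all add: algebra_simps)
    then have "sum (J i) {..t} < r + 1" "r < sum (J i) {..t} + 1"
      unfolding mult_less_cancel1 by blast+
    then have "sum (J i) {..t} = r" by linarith
    moreover have "sum (J i) {..t} = J i t + sum (J i) {..<t}"
      unfolding lessThan_Suc_atMost[symmetric] by simp
    ultimately show ?thesis by simp
  qed
  have J_le: "J i v \<le> df i v" if "i \<in> {1..k}" "v < t" for i v
  proof (rule ccontr)
    assume "\<not> ?thesis"
    then have "p * (df i v + 1) \<le> p * J i v" by (intro mult_left_mono) auto
    then have "p * df i v + p \<le> p * J i v" by simp
    moreover have "df i v \<le> p * df i v" using p(1) by simp
    moreover have "p * J i v < df i v + p" using J_elem[of i v] that by (simp add: c_def)
    ultimately show False by linarith
  qed
  \<comment> \<open>\<open>J i t\<close> loops become edges between the new vertex and the remaining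
    amalgamated one. Each uses up two loop ends, and evenness of \<open>c i t\<close> makes the
    rounded share fit even for \<open>p = 2\<close>.\<close>
  have J_root: "2 * J i t \<le> c i t" if "i \<in> {1..k}" for i
  proof -
    have "even (c i t)" using that by (rule c_root(2))
    then obtain l where l: "c i t = 2 * l" by blast
    show ?thesis
    proof (rule ccontr)
      assume "\<not> ?thesis"
      then have "p * (l + 1) \<le> p * J i t" using l by (intro mult_left_mono) auto
      then have "p * l + p \<le> p * J i t" by simp
      moreover have "2 * l \<le> p * l" using p(1) by simp
      moreover have "p * J i t < 2 * l + p" using J_elem[of i t] that l by simp
      ultimately show False by linarith
    qed
  qed
  define b where "b i = attach (a i) t (J i)" for i
  have sum_col: "(\<Sum>i\<in>{1..k}. b i e) = \<mu>" if "e \<in> pairs (Suc t)" for e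
    using that
  proof (cases rule: pairs_SucE)
    case 1
    then show ?thesis using ext by (simp add: b_def attach_pairs extendable_def)
  next
    case (2 u)
    then show ?thesis using J_col[of u] by (simp add: b_def attach_new)
  qed
  have color: "(\<forall>v<Suc t. mdeg (b i) (Suc t) v \<le> r) \<and>
      r * Suc t \<le> r * (m - Suc t) + (\<Sum>v<Suc t. mdeg (b i) (Suc t) v) \<and>
      (\<forall>X\<subseteq>{..<Suc t}. X \<noteq> {} \<longrightarrow> 2 \<le> cut_size (b i) (Suc t) X + (\<Sum>v\<in>X. r - mdeg (b i) (Suc t) v))"
    if i: "i \<in> {1..k}" for i
  proof (intro conjI allI impI)
    have dg_b: "mdeg (b i) (Suc t) v = mdeg (a i) t v + J i v" if "v < t" for v
      using that by (simp add: b_def mdeg_attach)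
    have dg_bt: "mdeg (b i) (Suc t) t = sum (J i) {..<t}" by (simp add: b_def mdeg_attach_new)
    show "mdeg (b i) (Suc t) v \<le> r" if "v < Suc t" for v
      using that dg_b[of v] dg_bt J_le[OF i, of v] dg_le[OF i, of v] J_row[OF i]
      by (cases "v = t") (auto simp: df_def)
    have "(\<Sum>v<Suc t. mdeg (b i) (Suc t) v) = (\<Sum>v<t. mdeg (a i) t v) + 2 * sum (J i) {..<t}"
      using dg_b dg_bt by (simp add: sum.distrib)
    moreover have "r * p = r * (p - 1) + r" using p(1) by (cases p) auto
    ultimately show "r * Suc t \<le> r * (m - Suc t) + (\<Sum>v<Suc t. mdeg (b i) (Suc t) v)"
      using J_root[OF i] c_root(1)[OF i] sum_df[OF i] J_row[OF i] p(3) by simp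
    fix X assume X: "X \<subseteq> {..<Suc t}" "X \<noteq> {}"
    have old: "(\<Sum>v\<in>Y. r - mdeg (b i) (Suc t) v) + sum (J i) Y = sum (df i) Y" if "Y \<subseteq> {..<t}" for Y
      unfolding sum.distrib[symmetric]
    proof (rule sum.cong)
      fix v assume "v \<in> Y"
      then have "v < t" using that by blast
      then show "r - mdeg (b i) (Suc t) v + J i v = df i v"
        using dg_b[of v] J_le[OF i, of v] unfolding df_def by linarith
    qed simp
    show "2 \<le> cut_size (b i) (Suc t) X + (\<Sum>v\<in>X. r - mdeg (b i) (Suc t) v)"
    proof (cases "t \<in> X")
      case False
      then have Xt: "X \<subseteq> {..<t}" using X by (auto simp: less_Suc_eq)
      have "2 \<le> cut_size (a i) t X + sum (df i) X" using extendableD(3)[OF ext i Xt X(2)] by (simp add: df_def)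
      then show ?thesis using old[OF Xt] cut_attach[OF Xt] by (simp add: b_def)
    next
      case True
      define Z where "Z = X - {t}"
      have Z: "X = insert t Z" "Z \<subseteq> {..<t}" "t \<notin> Z" "finite Z"
        using True X finite_subset[of X "{..<Suc t}"] by (auto simp: Z_def less_Suc_eq)
      have subD: "sum (c i) (desc {..t} (par i) v) = sum (df i) (desc {..t} (par i) v)" if "v < t" for v
      proof -
        have "t \<notin> desc {..t} (par i) v"
        proof
          assume "t \<in> desc {..t} (par i) v"
          moreover have "(par i ^^ j) t = t" for j
            using rooted_tree.par_root[OF tree[of i]] by (induction j) auto
          ultimately show False using that by (auto simp: desc_def)
        qed
        then have "u < t" if "u \<in> desc {..t} (par i) v" for u
          using that by (cases "u = t") (auto simp: desc_def)
        then show ?thesis by (intro sum.cong) (auto simp: c_def)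
      qed
      \<comment> \<open>Cut plus deficit of \<open>insert t Z\<close> equals
        \<open>cut_size (a i) t Z + sum (df i) Z + r - 2 * sum (J i) Z\<close>: an edge from
        \<open>t\<close> to \<open>Z\<close> does not leave the set, and it costs a unit of deficit
        at both ends.\<close>
      have "2 * sum (J i) Z + 2 \<le> cut_size (a i) t Z + sum (df i) Z + r"
      proof (rule balanced_split[OF tree edge root, where p = p])
        show "2 \<le> cut_size (a i) t Y + sum (df i) Y" if "Y \<subseteq> {..<t}" "Y \<noteq> {}" for Y
          using extendableD(3)[OF ext i that] by (simp add: df_def)
        show "p * sum (J i) (desc {..t} (par i) v) < sum (df i) (desc {..t} (par i) v) + p"
          "sum (df i) (desc {..t} (par i) v) < p * sum (J i) (desc {..t} (par i) v) + p" if "v < t" for v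
          using J_sub[OF i, of v] subD[OF that] that by auto
        show "sum (J i) {..<t} \<le> r" using J_row[OF i] by simp
      qed (use J_le[OF i] p(1) r Z in auto)
      moreover have "sum (J i) {..<t} = sum (J i) Z + sum (J i) ({..<t} - Z)"
        using sum.subset_diff[OF Z(2), of "J i"] by simp
      moreover have "cut_size (b i) (Suc t) X = cut_size (a i) t Z + sum (J i) ({..<t} - Z)"
        unfolding Z(1) b_def using Z(2) by (rule cut_attach_new)
      moreover have "(\<Sum>v\<in>X. r - mdeg (b i) (Suc t) v) = (r - sum (J i) {..<t}) + (\<Sum>v\<in>Z. r - mdeg (b i) (Suc t) v)"
        using Z dg_bt by simp
      ultimately show ?thesis using old[OF Z(2)] J_row[OF i] by linarith
    qed
  qed
  have "extendable \<mu> r k m (Suc t) b"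
    using sum_col color unfolding extendable_def by blast
  moreover have "\<forall>i\<in>{1..k}. \<forall>e\<in>pairs t. b i e = a i e" by (simp add: b_def attach_pairs)
  ultimately show ?thesis by blast
qed

lemma pairs_mono: "s \<le> t \<Longrightarrow> pairs s \<subseteq> pairs t"
  by (auto simp: pairs_def)

text \<open>A split needs at least two amalgamated vertices, so the iteration stops at
  \<open>m - 1\<close>.\<close>

lemma extend_until_last:
  assumes "extendable \<mu> r k m n a" and "r * k = \<mu> * (m - 1)" and "even (r * m)"
    and "3 \<le> r" and "n < m"
  shows "\<exists>b. extendable \<mu> r k m (m - 1) b \<and> (\<forall>i\<in>{1..k}. \<forall>e\<in>pairs n. b i e = a i e)"
proof -
  have "\<exists>b. extendable \<mu> r k m t b \<and> (\<forall>i\<in>{1..k}. \<forall>e\<in>pairs n. b i e = a i e)"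
    if "n \<le> t" "t < m" for t
    using that
  proof (induction t rule: dec_induct)
    case base
    then show ?case using assms by blast
  next
    case (step t)
    then obtain b where b: "extendable \<mu> r k m t b" "\<forall>i\<in>{1..k}. \<forall>e\<in>pairs n. b i e = a i e" by auto
    obtain b' where "extendable \<mu> r k m (Suc t) b'" "\<forall>i\<in>{1..k}. \<forall>e\<in>pairs t. b' i e = b i e"
      using extend_one[OF b(1) assms(2-4)] step.prems by auto
    moreover have "pairs n \<subseteq> pairs t" using step.hyps by (intro pairs_mono) auto
    ultimately show ?case using b(2) by (metis subset_iff)
  qed
  then show ?thesis using assms(5) by auto
qed

text \<open>The amalgamated vertex is now the last vertex itself, provided that it has no loops.
  Each color has at most \<open>r\<close> edges there, and the total over the colors is
  \<open>\<mu> * t = r * k\<close>, so equality holds in every color.\<close>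

lemma extend_last:
  assumes ext: "extendable \<mu> r k (Suc t) t a" and rk: "r * k = \<mu> * t"
  shows "\<exists>b. (\<forall>e\<in>pairs (Suc t). (\<Sum>i\<in>{1..k}. b i e) = \<mu>) \<and> (\<forall>i\<in>{1..k}. \<forall>e\<in>pairs t. b i e = a i e) \<and>
    (\<forall>i\<in>{1..k}. (\<forall>v<Suc t. mdeg (b i) (Suc t) v = r) \<and>
      (\<forall>X\<subseteq>{..<Suc t}. X \<noteq> {} \<longrightarrow> X \<noteq> {..<Suc t} \<longrightarrow> 2 \<le> cut_size (b i) (Suc t) X))"
proof -
  define df where "df i v = r - mdeg (a i) t v" for i v
  define b where "b i = attach (a i) t (df i)" for i
  have dg_le: "mdeg (a i) t v \<le> r" if "i \<in> {1..k}" "v < t" for i v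
    by (rule extendableD(1)[OF ext that])
  have col: "(\<Sum>i\<in>{1..k}. df i v) = \<mu>" if "v < t" for v
    using extendable_deficit_sum[OF ext _ that] rk by (simp add: df_def)
  have le: "sum (df i) {..<t} \<le> r" if "i \<in> {1..k}" for i
  proof -
    have "(\<Sum>v<t. df i v) + (\<Sum>v<t. mdeg (a i) t v) = r * t"
      unfolding df_def sum.distrib[symmetric] using dg_le[OF that] by (simp add: mult.commute)
    then show ?thesis using extendableD(2)[OF ext that] by simp
  qed
  have total: "(\<Sum>i\<in>{1..k}. sum (df i) {..<t}) = (\<Sum>i\<in>{1..k}. r)"
  proof -
    have "(\<Sum>i\<in>{1..k}. sum (df i) {..<t}) = (\<Sum>v<t. \<Sum>i\<in>{1..k}. df i v)" by (rule sum.swap)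
    then show ?thesis using col rk by (simp add: mult.commute)
  qed
  have eq: "sum (df i) {..<t} = r" if "i \<in> {1..k}" for i
  proof (rule ccontr)
    assume "sum (df i) {..<t} \<noteq> r"
    then have "sum (df i) {..<t} < r" using le[OF that] by simp
    then have "(\<Sum>i\<in>{1..k}. sum (df i) {..<t}) < (\<Sum>i\<in>{1..k}. r)"
      using le that by (intro sum_strict_mono_ex1) auto
    then show False using total by simp
  qed
  have "(\<Sum>i\<in>{1..k}. b i e) = \<mu>" if "e \<in> pairs (Suc t)" for e
    using that
  proof (cases rule: pairs_SucE)
    case 1
    then show ?thesis using ext by (simp add: b_def attach_pairs extendable_def)
  next
    case (2 u)
    then show ?thesis using col[of u] by (simp add: b_def attach_new)
  qed
  moreover have "\<forall>i\<in>{1..k}. \<forall>e\<in>pairs t. b i e = a i e" by (simp add: b_def attach_pairs)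
  moreover have "mdeg (b i) (Suc t) v = r" if "i \<in> {1..k}" "v < Suc t" for i v
    using that dg_le[of i v] eq[of i] by (cases "v = t") (auto simp: b_def mdeg_attach mdeg_attach_new df_def)
  moreover have "2 \<le> cut_size (b i) (Suc t) X"
    if i: "i \<in> {1..k}" and X: "X \<subseteq> {..<Suc t}" "X \<noteq> {}" "X \<noteq> {..<Suc t}" for i X
  proof -
    have cuts: "2 \<le> cut_size (a i) t Y + sum (df i) Y" if "Y \<subseteq> {..<t}" "Y \<noteq> {}" for Y
      using extendableD(3)[OF ext i that] by (simp add: df_def)
    show ?thesis
    proof (cases "t \<in> X")
      case False
      then have "X \<subseteq> {..<t}" using X by (auto simp: less_Suc_eq)
      then show ?thesis using cuts[of X] X(2) by (simp add: b_def cut_attach)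
    next
      case True
      define Z where "Z = X - {t}"
      have Z: "X = insert t Z" "Z \<subseteq> {..<t}"
        using True X by (auto simp: Z_def less_Suc_eq)
      then have "{..<t} - Z \<noteq> {}" using X(3) by (auto simp: lessThan_Suc)
      then show ?thesis
        using cuts[of "{..<t} - Z"] cut_complement[OF Z(2)] cut_attach_new[OF Z(2)] by (simp add: Z(1) b_def)
    qed
  qed
  ultimately show ?thesis by blast
qed

theorem extend_to_factorization:
  assumes "extendable \<mu> r k m n a" and "r * k = \<mu> * (m - 1)" and "even (r * m)"
    and "3 \<le> r" and "n < m"
  shows "\<exists>b. (\<forall>e\<in>pairs m. (\<Sum>i\<in>{1..k}. b i e) = \<mu>) \<and> (\<forall>i\<in>{1..k}. \<forall>e\<in>pairs n. b i e = a i e) \<and>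
    (\<forall>i\<in>{1..k}. (\<forall>v<m. mdeg (b i) m v = r) \<and>
      (\<forall>X\<subseteq>{..<m}. X \<noteq> {} \<longrightarrow> X \<noteq> {..<m} \<longrightarrow> 2 \<le> cut_size (b i) m X))"
proof -
  obtain a' where a': "extendable \<mu> r k m (m - 1) a'" "\<forall>i\<in>{1..k}. \<forall>e\<in>pairs n. a' i e = a i e"
    using extend_until_last[OF assms] by blast
  have m: "Suc (m - 1) = m" using assms(5) by simp
  have "pairs n \<subseteq> pairs (m - 1)" using assms(5) by (intro pairs_mono) simp
  then show ?thesis
    using extend_last[of \<mu> r k "m - 1" a'] a' assms(2) unfolding m by (metis subset_iff)
qed

section \<open>Matchings\<close>

text \<open>The elements are numbered and sorted by residue modulo \<open>q\<close>.\<close>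

lemma equitable_partition:
  assumes "finite S" and "0 < (q::nat)"
  shows "\<exists>h. (\<forall>e\<in>S. h e < q) \<and> (\<forall>b<q. card S div q \<le> card {e \<in> S. h e = b})"
proof -
  obtain g where g: "bij_betw g S {0..<card S}"
    using assms(1) ex_bij_betw_finite_nat by blast
  have "card S div q \<le> card {e \<in> S. g e mod q = b}" if b: "b < q" for b
  proof -
    have "b + j * q < card S" if "j < card S div q" for j
    proof -
      have "Suc j * q \<le> card S div q * q" using that by (intro mult_right_mono) auto
      also have "\<dots> \<le> card S" by simp
      finally show ?thesis using b by simp
    qed
    then have "(\<lambda>j. b + j * q) ` {..<card S div q} \<subseteq> {j. j < card S \<and> j mod q = b}"
      using b by auto
    then have "card ((\<lambda>j. b + j * q) ` {..<card S div q}) \<le> card {j. j < card S \<and> j mod q = b}"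
      by (intro card_mono) auto
    then have "card S div q \<le> card {j. j < card S \<and> j mod q = b}"
      using assms(2) by (simp add: card_image inj_on_def)
    also have "{j. j < card S \<and> j mod q = b} = g ` {e \<in> S. g e mod q = b}"
      using g by (auto simp: bij_betw_def image_iff)
    also have "card \<dots> = card {e \<in> S. g e mod q = b}"
      using g by (intro card_image) (auto simp: bij_betw_def inj_on_def)
    finally show ?thesis .
  qed
  then show ?thesis using assms(2) by (intro exI[of _ "\<lambda>e. g e mod q"]) auto
qed

lemma add_mod_left_cancel:
  fixes u u' v n :: nat
  assumes "u < n" "u' < n" "(v + u) mod n = (v + u') mod n"
  shows "u = u'"
proof -
  have "a = b" if "a \<le> b" "b < n" "(v + b) mod n = (v + a) mod n" for a b
  proof -
    have "n dvd (v + b) - (v + a)" using that mod_eq_dvd_iff_nat[of "v + a" "v + b" n] by simp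
    then have "n dvd b - a" by simp
    then show ?thesis using that by (auto dest: dvd_imp_le)
  qed
  then show ?thesis using assms by (metis nat_le_linear)
qed

text \<open>Each \<open>v\<close> has the partner \<open>c - v\<close> modulo \<open>n\<close>. It
  stays unmatched only if \<open>2 * v\<close> is \<open>c\<close> or \<open>c + n\<close>, which
  excludes at most two vertices.\<close>

lemma card_pairs_sum_class:
  assumes "c < n"
  shows "n \<le> 2 * card {e \<in> pairs n. \<Sum> e mod n = c} + 2"
proof -
  define S where "S = {e \<in> pairs n. \<Sum> e mod n = c}"
  have fin: "finite S" by (simp add: S_def)
  have "{..<n} \<subseteq> \<Union> S \<union> {c div 2, (c + n) div 2}"
  proof
    fix v assume "v \<in> {..<n}"
    then have v: "v < n" by simp
    define u where "u = (c + n - v) mod n"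
    have "(v + u) mod n = (v + (c + n - v)) mod n" by (simp add: u_def mod_add_right_eq)
    then have uv: "(v + u) mod n = c" "u < n" using v assms by (simp_all add: u_def)
    show "v \<in> \<Union> S \<union> {c div 2, (c + n) div 2}"
    proof (cases "u = v")
      case True
      then have "2 * v = c \<or> 2 * v = c + n"
        using uv v by (cases "v + v < n") (auto simp: le_mod_geq)
      then show ?thesis by auto
    next
      case False
      then have "{v, u} \<in> S" using uv v by (simp add: S_def doubleton_in_pairs)
      then show ?thesis by blast
    qed
  qed
  moreover have "finite (\<Union> S)" using fin by (auto simp: S_def pairs_def intro: finite_subset)
  ultimately have "n \<le> card (\<Union> S \<union> {c div 2, (c + n) div 2})"
    using card_mono[of "\<Union> S \<union> {c div 2, (c + n) div 2}" "{..<n}"] by simp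
  also have "\<dots> \<le> card (\<Union> S) + card {c div 2, (c + n) div 2}" by (rule card_Un_le)
  also have "\<dots> \<le> card (\<Union> S) + 2" by (simp add: card_insert_if)
  also have "card (\<Union> S) \<le> (\<Sum>e\<in>S. card e)" by (rule card_Union_le_sum_card)
  also have "(\<Sum>e\<in>S. card e) = 2 * card S" by (simp add: S_def pairs_def)
  finally show ?thesis by (simp add: S_def)
qed

text \<open>
  The edges of \<open>K\<^sub>n\<close> whose ends have a given sum modulo \<open>n\<close> form a matching. The \<open>\<delta>\<close> copies of these
  matchings are spread over the colors congruent to a given residue modulo \<open>\<delta> n\<close>.
\<close>

lemma balanced_matchings:
  assumes n: "0 < n" and k: "\<delta> * n \<le> k"
  shows "\<exists>M :: nat \<Rightarrow> nat set \<Rightarrow> nat. (\<forall>e\<in>pairs n. (\<Sum>i\<in>{1..k}. M i e) = \<delta>) \<and>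
    (\<forall>i\<in>{1..k}. (\<forall>v<n. mdeg (M i) n v \<le> 1) \<and>
      (\<forall>q. 0 < \<delta> \<longrightarrow> k \<le> q * (\<delta> * n) \<longrightarrow> n \<le> q * (\<Sum>v<n. mdeg (M i) n v) + 2 * q))"
proof (cases "\<delta> = 0")
  case True
  then show ?thesis by (intro exI[of _ "\<lambda>_ _. 0"]) (simp add: mdeg_def)
next
  case False
  define N where "N = \<delta> * n"
  have N: "0 < N" "n dvd N" "N \<le> k" using False n k by (auto simp: N_def)
  define cl where "cl e = \<Sum> e mod n" for e :: "nat set"
  define S where "S c = {e \<in> pairs n. cl e = c}" for c
  \<comment> \<open>The number of colors, counted from zero, that are congruent to \<open>x\<close>
    modulo \<open>N\<close>; \<open>N \<le> k\<close> makes it positive for every residue.\<close>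
  define Q where "Q x = (k - 1 - x) div N + 1" for x
  have Q: "b < Q x \<longleftrightarrow> x + N * b < k" if "x < N" for b x
  proof -
    have "b < Q x \<longleftrightarrow> b * N \<le> k - 1 - x"
      using N by (simp add: Q_def less_Suc_eq_le less_eq_div_iff_mult_less_eq)
    also have "\<dots> \<longleftrightarrow> x + N * b < k" using that N by (auto simp: mult.commute)
    finally show ?thesis .
  qed
  have "\<forall>x. \<exists>h. (\<forall>e\<in>S (x mod n). h e < Q x) \<and>
      (\<forall>b<Q x. card (S (x mod n)) div Q x \<le> card {e \<in> S (x mod n). h e = b})"
    by (intro allI equitable_partition) (auto simp: S_def Q_def)
  from choice[OF this] obtain h where h_all: "\<forall>x. (\<forall>e\<in>S (x mod n). h x e < Q x) \<and>
      (\<forall>b<Q x. card (S (x mod n)) div Q x \<le> card {e \<in> S (x mod n). h x e = b})" ..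
  have h: "\<And>e. e \<in> S (x mod n) \<Longrightarrow> h x e < Q x"
    "\<And>b. b < Q x \<Longrightarrow> card (S (x mod n)) div Q x \<le> card {e \<in> S (x mod n). h x e = b}" for x
    using h_all by blast+
  \<comment> \<open>The residue \<open>j mod N\<close> stands for one copy of the matching with sum
    \<open>j mod n\<close>, and \<open>j div N\<close> numbers the portion of that copy given to
    color \<open>j + 1\<close>.\<close>
  define P where "P j e \<longleftrightarrow> cl e = j mod n \<and> h (j mod N) e = j div N" for j e
  define M where "M i e = (of_bool (P (i - 1) e) :: nat)" for i e
  have mod_mod: "j mod N mod n = j mod n" for j using N(2) by (rule mod_mod_cancel)
  have cols: "(\<Sum>i\<in>{1..k}. M i e) = \<delta>" if e: "e \<in> pairs n" for e
  proof -
    \<comment> \<open>The \<delta> residues modulo \<open>N\<close> that reduce to the sum class of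
      \<open>e\<close>; each accounts for exactly one color containing \<open>e\<close>.\<close>
    define x where "x s = cl e + s * n" for s
    have cl: "cl e < n" using n by (simp add: cl_def)
    have x: "x s < N" "x s mod n = cl e" if "s < \<delta>" for s
    proof -
      have "Suc s * n \<le> N" unfolding N_def using that by (intro mult_right_mono) auto
      then show "x s < N" "x s mod n = cl e" using cl by (auto simp: x_def)
    qed
    have "bij_betw (\<lambda>s. x s + N * h (x s) e) {..<\<delta>} {j. j < k \<and> P j e}"
    proof (rule bij_betw_imageI)
      show "inj_on (\<lambda>s. x s + N * h (x s) e) {..<\<delta>}"
      proof (rule inj_onI)
        fix s s' assume s: "s \<in> {..<\<delta>}" "s' \<in> {..<\<delta>}" "x s + N * h (x s) e = x s' + N * h (x s') e"
        then have "x s = x s'" using x(1) by (metis lessThan_iff mod_less mod_mult_self2)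
        then show "s = s'" using n by (simp add: x_def)
      qed
      show "(\<lambda>s. x s + N * h (x s) e) ` {..<\<delta>} = {j. j < k \<and> P j e}"
      proof (intro equalityI subsetI)
        fix j assume "j \<in> (\<lambda>s. x s + N * h (x s) e) ` {..<\<delta>}"
        then obtain s where s: "s < \<delta>" "j = x s + N * h (x s) e" by auto
        have "h (x s) e < Q (x s)" using h(1) x(2)[OF s(1)] e by (simp add: S_def)
        then have "j < k" using Q[OF x(1)] s by simp
        moreover have "j mod N = x s" "j div N = h (x s) e" using s x(1)[OF s(1)] N(1) by auto
        ultimately show "j \<in> {j. j < k \<and> P j e}"
          using mod_mod[of j] x(2)[OF s(1)] by (simp add: P_def)
      next
        fix j assume "j \<in> {j. j < k \<and> P j e}"
        then have j: "j < k" "cl e = j mod n" "h (j mod N) e = j div N" by (auto simp: P_def)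
        define s where "s = j mod N div n"
        have "s < \<delta>" unfolding s_def using N(1) by (intro less_mult_imp_div_less) (simp add: N_def)
        moreover have xs: "x s = j mod N"
          unfolding x_def s_def j(2) mod_mod[of j, symmetric] by simp
        moreover have "j = x s + N * h (x s) e" unfolding xs j(3) by simp
        ultimately show "j \<in> (\<lambda>s. x s + N * h (x s) e) ` {..<\<delta>}" by blast
      qed
    qed
    then have "card {j. j < k \<and> P j e} = \<delta>" using bij_betw_same_card by fastforce
    moreover have "(\<Sum>i\<in>{1..k}. M i e) = (\<Sum>j<k. of_bool (P j e))"
      by (simp add: M_def sum.atLeast1_atMost_eq)
    moreover have "(\<Sum>j<k. of_bool (P j e) :: nat) = card {j. j < k \<and> P j e}"
    proof -
      have "{j. j < k \<and> P j e} = {..<k} \<inter> {j. P j e}" by auto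
      then show ?thesis by simp
    qed
    ultimately show ?thesis by simp
  qed
  have match: "mdeg (M i) n v \<le> 1" if "v < n" for i v
  proof -
    let ?U = "{u \<in> {..<n} - {v}. P (i - 1) {v, u}}"
    have "u = u'" if "u \<in> ?U" "u' \<in> ?U" for u u'
    proof (rule add_mod_left_cancel)
      show "(v + u) mod n = (v + u') mod n" using that by (auto simp: P_def cl_def)
    qed (use that in auto)
    then have "card ?U \<le> 1" using card_le_Suc0_iff_eq[of ?U] by auto
    moreover have "mdeg (M i) n v = card ?U"
      unfolding mdeg_def M_def by (simp add: Int_def)
    ultimately show ?thesis by simp
  qed
  \<comment> \<open>At most \<open>q\<close> colors share a copy, so each gets at least
    \<open>card S div q\<close> of its edges, where \<open>n \<le> 2 * card S + 2\<close>. The term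
    \<open>2 * q\<close> pays for the division and for the two unmatched vertices.\<close>
  have large: "n \<le> q * (\<Sum>v<n. mdeg (M i) n v) + 2 * q"
    if i: "i \<in> {1..k}" and q: "k \<le> q * (\<delta> * n)" for i q
  proof -
    define j where "j = i - 1"
    define x where "x = j mod N"
    have j: "j < k" using i by (auto simp: j_def)
    have xN: "x < N" using N by (simp add: x_def)
    have xn: "x mod n = j mod n" using mod_mod by (simp add: x_def)
    have "j div N < Q x" using Q[OF xN, of "j div N"] j by (simp add: x_def)
    then have "card (S (x mod n)) div Q x \<le> card {e \<in> S (x mod n). h x e = j div N}" by (rule h(2))
    also have "{e \<in> S (x mod n). h x e = j div N} = {e \<in> pairs n. P j e}"
      by (auto simp: S_def P_def xn x_def[symmetric])
    finally have c: "card (S (x mod n)) div Q x \<le> card {e \<in> pairs n. P j e}" .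
    have "0 < k" using j by simp
    then have q0: "0 < q" using q by (cases q) auto
    have "(k - 1 - x) div N < q"
      using q q0 \<open>0 < k\<close> by (intro less_mult_imp_div_less) (simp add: N_def)
    then have "Q x \<le> q" by (simp add: Q_def)
    then have "card (S (x mod n)) div q \<le> card (S (x mod n)) div Q x"
      by (rule div_le_mono2[rotated]) (simp add: Q_def)
    with c have "q * (card (S (x mod n)) div q) \<le> q * card {e \<in> pairs n. P j e}" by simp
    moreover have "card (S (x mod n)) < q * (card (S (x mod n)) div q) + q"
      using q0 by (metis add.commute dividend_less_times_div)
    moreover have "n \<le> 2 * card (S (x mod n)) + 2"
      using card_pairs_sum_class[of "x mod n" n] n by (simp add: S_def cl_def)
    ultimately have "n \<le> 2 * (q * card {e \<in> pairs n. P j e}) + 2 * q" by linarith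
    moreover have "(\<Sum>v<n. mdeg (M i) n v) = 2 * card {e \<in> pairs n. P j e}"
      unfolding handshake M_def j_def by (simp add: Int_def)
    ultimately show ?thesis by (simp only: mult.left_commute)
  qed
  show ?thesis using cols match large by (intro exI[of _ M]) blast
qed

section \<open>From multigraphs to multiplicities and back\<close>

lemma complete_mgraph_pairs: "complete_mgraph l n = \<lparr>verts = {..<n}, edges = repeat_mset l (mset_set (pairs n))\<rparr>"
  by (simp add: complete_mgraph_def pairs_def)

lemma wf_mgraph_pairs:
  "wf_mgraph H \<Longrightarrow> verts H = {..<n} \<Longrightarrow> e \<in># edges H \<Longrightarrow> e \<in> pairs n"
  by (auto simp: wf_mgraph_def pairs_def)

lemma deg_eq_mdeg:
  assumes "wf_mgraph H" "verts H = {..<n}" "v < n"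
  shows "deg H v = mdeg (count (edges H)) n v"
proof -
  have "deg H v = (\<Sum>e\<in>{e \<in> set_mset (edges H). v \<in> e}. count (edges H) e)"
    by (simp add: deg_def size_multiset_overloaded_eq)
  also have "\<dots> = (\<Sum>e | e \<in> pairs n \<and> v \<in> e. count (edges H) e)"
    using wf_mgraph_pairs[OF assms(1,2)] by (intro sum.mono_neutral_left) (auto simp: not_in_iff)
  finally show ?thesis using assms(3) by (simp add: mdeg_pairs)
qed

section \<open>Reachability and components\<close>

lemma reachable_closed:
  assumes "reachable H u v" and "u \<in> X" and "\<And>x y. x \<in> X \<Longrightarrow> {x, y} \<in># edges H \<Longrightarrow> y \<in> X"
  shows "v \<in> X"
  using assms(1,2) unfolding reachable_def by (induction rule: rtranclp_induct) (auto intro: assms(3))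

lemma reachable_refl: "reachable H u u"
  by (simp add: reachable_def)

lemma reachable_trans: "reachable H u v \<Longrightarrow> reachable H v w \<Longrightarrow> reachable H u w"
  unfolding reachable_def by (rule rtranclp_trans)

lemma reachable_edge: "{u, v} \<in># edges H \<Longrightarrow> reachable H u v"
  unfolding reachable_def by (rule r_into_rtranclp)

lemma reachable_sym: "reachable H u v \<Longrightarrow> reachable H v u"
  unfolding reachable_def
proof (induction rule: rtranclp_induct)
  case (step y z)
  have "{z, y} \<in># edges H" using step.hyps(2) by (simp add: insert_commute)
  then show ?case using step.IH by (rule converse_rtranclp_into_rtranclp)
qed simp

text \<open>All vertices on a walk from \<open>x\<close> are reachable from \<open>x\<close>, so the
  walk stays in the induced subgraph.\<close>

lemma reachable_component:
  assumes "wf_mgraph H" and "x \<in> verts H" and "reachable H x v"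
  shows "reachable (induced H {v \<in> verts H. reachable H x v}) x v"
proof -
  let ?K = "induced H {v \<in> verts H. reachable H x v}"
  have "v \<in> {v \<in> verts H. reachable H x v \<and> reachable ?K x v}"
  proof (rule reachable_closed[OF assms(3)])
    show "x \<in> {v \<in> verts H. reachable H x v \<and> reachable ?K x v}"
      using assms(2) by (simp add: reachable_refl)
    fix u w assume u: "u \<in> {v \<in> verts H. reachable H x v \<and> reachable ?K x v}" and uw: "{u, w} \<in># edges H"
    have w: "w \<in> verts H" "reachable H x w"
      using assms(1) uw u reachable_trans[OF _ reachable_edge[OF uw]] by (auto simp: wf_mgraph_def)
    then have "{u, w} \<in># edges ?K" using u uw by (simp add: induced_def)
    then have "reachable ?K u w" by (rule reachable_edge)
    then show "w \<in> {v \<in> verts H. reachable H x v \<and> reachable ?K x v}"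
      using w u reachable_trans[of ?K x u w] by simp
  qed
  then show ?thesis by blast
qed

text \<open>\<open>cutedge\<close> compares numbers of components. A component counts as one, so two
  different components after a deletion are enough to exhibit a cutedge.\<close>

lemma components_component:
  assumes "wf_mgraph H" and "x \<in> verts H"
  defines "K \<equiv> induced H {v \<in> verts H. reachable H x v}"
  shows "components K \<subseteq> {K}"
proof
  fix Y assume "Y \<in> components K"
  then obtain u where u: "u \<in> verts K" "Y = induced K {v \<in> verts K. reachable K u v}"
    by (auto simp: components_def)
  have from_x: "reachable K x v" if "v \<in> verts K" for v
    using that reachable_component[OF assms(1,2)] by (simp add: K_def induced_def)
  have "reachable K u v" if "v \<in> verts K" for v
    using reachable_trans[OF reachable_sym[OF from_x[OF u(1)]] from_x[OF that]] .
  then have "Y = induced K (verts K)" using u(2) by (simp add: Collect_conj_eq2 cong: conj_cong)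
  also have "\<dots> = K" by (simp add: K_def induced_def filter_filter_mset)
  finally show "Y \<in> {K}" by simp
qed

lemma unit_cut_edge:
  assumes "X \<subseteq> {..<n}" and "cut_size a n X = 1"
  obtains x y where "x \<in> X" "y \<in> {..<n} - X" "a {x, y} = 1"
    "\<And>u v. u \<in> X \<Longrightarrow> v \<in> {..<n} - X \<Longrightarrow> {u, v} \<noteq> {x, y} \<Longrightarrow> a {u, v} = 0"
proof -
  let ?A = "X \<times> ({..<n} - X)"
  have "(\<Sum>q\<in>?A. a {fst q, snd q}) = 1"
    using assms(2) by (simp add: cut_size_def sum.cartesian_product case_prod_beta)
  moreover have "finite ?A" using assms(1) finite_subset by blast
  ultimately have "\<exists>q\<in>?A. a {fst q, snd q} = 1 \<and> (\<forall>q'\<in>?A. q \<noteq> q' \<longrightarrow> a {fst q', snd q'} = 0)"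
    by (simp only: sum_eq_1_iff)
  then obtain q where q: "q \<in> X \<times> ({..<n} - X)" "a {fst q, snd q} = 1"
    "\<forall>q'\<in>X \<times> ({..<n} - X). q \<noteq> q' \<longrightarrow> a {fst q', snd q'} = 0"
    by blast
  show ?thesis
  proof (rule that[of "fst q" "snd q"])
    show "a {u, v} = 0" if "u \<in> X" "v \<in> {..<n} - X" "{u, v} \<noteq> {fst q, snd q}" for u v
    proof -
      have "q \<noteq> (u, v)" using that(3) by auto
      then show ?thesis using q(3) that(1,2) by force
    qed
  qed (use q in auto)
qed

text \<open>
  Raising the degree bound from \<open>r - 1\<close> to \<open>r\<close> gives every vertex one more unit of deficit, which
  pays for its edge in the matching; so the deficits provided by admissibility survive.
\<close>

lemma admissible_add_matching:
  fixes H :: "nat mgraph"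
  assumes wf: "wf_mgraph H" and vH: "verts H = {..<n}" and r: "3 \<le> r"
    and deg_le: "\<And>v. v < n \<Longrightarrow> deg H v \<le> r - 1"
    and comp: "\<And>K. K \<in> components H \<Longrightarrow> (\<exists>v\<in>verts K. deg H v \<le> r - 3) \<or>
      (\<exists>u\<in>verts K. \<exists>v\<in>verts K. u \<noteq> v \<and> deg H u \<le> r - 2 \<and> deg H v \<le> r - 2)"
    and cutedges: "\<And>K e Y. K \<in> components H \<Longrightarrow> cutedge K e \<Longrightarrow> Y \<in> components (del_edge K e) \<Longrightarrow>
      \<exists>v\<in>verts Y. deg H v \<le> r - 2"
    and M: "\<And>v. v < n \<Longrightarrow> mdeg M n v \<le> 1"
    and X: "X \<subseteq> {..<n}" "X \<noteq> {}"
  defines "a \<equiv> \<lambda>e. count (edges H) e + M e"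
  shows "2 \<le> cut_size a n X + (\<Sum>v\<in>X. r - mdeg a n v)"
proof -
  let ?c = "count (edges H)"
  have finX: "finite X" using X finite_subset by blast
  have dg_a: "mdeg a n v = deg H v + mdeg M n v" if "v < n" for v
    unfolding deg_eq_mdeg[OF wf vH that] by (simp add: mdeg_def a_def sum.distrib)
  have cut_a: "cut_size a n X = cut_size ?c n X + cut_size M n X"
    by (simp add: cut_size_def a_def sum.distrib)
  \<comment> \<open>The extra unit in the premise covers a possible matching edge at
    \<open>v\<close>.\<close>
  have slack: "d \<le> r - mdeg a n v" if "v \<in> X" "deg H v + d + 1 \<le> r" for v d
    using dg_a[of v] M[of v] that X by (simp add: subset_iff)
  have slack_sum: "d \<le> (\<Sum>v\<in>X. r - mdeg a n v)" if "v \<in> X" "deg H v + d + 1 \<le> r" for v d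
    using slack[OF that] member_le_sum[OF that(1) _ finX, of "\<lambda>v. r - mdeg a n v"] by simp
  have edge_in: "v \<in> X" if "u \<in> X" "{u, v} \<in># edges H" "v \<in> {..<n} - X \<Longrightarrow> ?c {u, v} = 0" for u v
    using that wf_mgraph_pairs[OF wf vH that(2)] by (auto simp: doubleton_in_pairs simp flip: not_in_iff)
  consider "2 \<le> cut_size ?c n X" | "cut_size ?c n X = 0" | "cut_size ?c n X = 1" by linarith
  then show ?thesis
  proof cases
    case 1
    then show ?thesis using cut_a by simp
  next
    case 2
    obtain x where x: "x \<in> X" using X by blast
    then have xH: "x \<in> verts H" using X vH by blast
    define K where "K = induced H {v \<in> verts H. reachable H x v}"
    have K: "K \<in> components H" using xH by (auto simp: components_def K_def)
    have "?c {u, v} = 0" if "u \<in> X" "v \<in> {..<n} - X" for u v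
      using 2 that finX by (simp add: cut_size_def)
    then have "v \<in> X" if "reachable H x v" for v
      using reachable_closed[OF that x] edge_in by blast
    \<comment> \<open>No edge of \<open>H\<close> leaves \<open>X\<close>, so \<open>X\<close>
      contains a whole component, and admissibility supplies deficit two there.\<close>
    then have KX: "verts K \<subseteq> X" by (auto simp: K_def induced_def)
    from comp[OF K] consider v where "v \<in> verts K" "deg H v \<le> r - 3"
      | u v where "u \<in> verts K" "v \<in> verts K" "u \<noteq> v" "deg H u \<le> r - 2" "deg H v \<le> r - 2" by blast
    then show ?thesis
    proof cases
      case 1
      then have "v \<in> X" "deg H v + 2 + 1 \<le> r" using KX r by auto
      then have "2 \<le> (\<Sum>v\<in>X. r - mdeg a n v)" by (rule slack_sum)
      then show ?thesis by simp
    next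
      case 2
      then have "1 \<le> r - mdeg a n u" "1 \<le> r - mdeg a n v" using slack[of _ 1] KX r by auto
      then have "2 \<le> (\<Sum>v\<in>{u, v}. r - mdeg a n v)" using 2(3) by simp
      also have "\<dots> \<le> (\<Sum>v\<in>X. r - mdeg a n v)" using 2 KX finX by (intro sum_mono2) auto
      finally show ?thesis by simp
    qed
  next
    case 3
    obtain x y where xy: "x \<in> X" "y \<in> {..<n} - X" "?c {x, y} = 1"
      and other: "\<And>u v. u \<in> X \<Longrightarrow> v \<in> {..<n} - X \<Longrightarrow> {u, v} \<noteq> {x, y} \<Longrightarrow> ?c {u, v} = 0"
      using unit_cut_edge[OF X(1) 3] by blast
    have xH: "x \<in> verts H" "y \<in> verts H" using xy X vH by auto
    define K where "K = induced H {v \<in> verts H. reachable H x v}"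
    have K: "K \<in> components H" using xH by (auto simp: components_def K_def)
    have exy: "{x, y} \<in># edges H" using xy(3) by (metis count_inI zero_neq_one)
    have xyK: "x \<in> verts K" "y \<in> verts K" "{x, y} \<in># edges K"
      using xH exy reachable_edge[OF exy] by (auto simp: K_def induced_def reachable_refl)
    let ?D = "del_edge K {x, y}"
    \<comment> \<open>The components of the two ends once the only edge leaving \<open>X\<close> is
      deleted. \<open>Y x\<close> stays inside \<open>X\<close> while \<open>y\<close> is outside,
      so the edge is a cutedge and \<open>Y x\<close> supplies the missing unit of deficit.\<close>
    define Y where "Y z = induced ?D {v \<in> verts ?D. reachable ?D z v}" for z
    have vD: "verts ?D = verts K" by (simp add: del_edge_def)
    have Yc: "Y z \<in> components ?D" if "z \<in> verts K" for z
      using that by (auto simp: components_def Y_def vD)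
    have "v \<in> X" if "reachable ?D x v" for v
      using that xy(1)
    proof (rule reachable_closed)
      fix u w assume uw: "u \<in> X" "{u, w} \<in># edges ?D"
      have "edges ?D \<subseteq># edges H - {#{x, y}#}"
        by (intro mset_subset_eqI) (auto simp: del_edge_def K_def induced_def)
      then have "{u, w} \<in># edges H - {#{x, y}#}" using uw(2) by (rule mset_subset_eqD)
      then have pos: "0 < count (edges H - {#{x, y}#}) {u, w}" by (simp only: count_greater_zero_iff)
      have "{u, w} \<in># edges H" using pos by (metis count_greater_zero_iff in_diffD)
      moreover have "?c {u, w} = 0" if "w \<in> {..<n} - X"
        using other[OF uw(1) that] pos xy(3) by (cases "{u, w} = {x, y}") auto
      ultimately show "w \<in> X" using edge_in uw(1) by blast
    qed
    then have YX: "verts (Y x) \<subseteq> X" by (auto simp: Y_def induced_def)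
    have "y \<in> verts (Y y)" using xyK by (simp add: Y_def induced_def vD reachable_refl)
    then have "Y x \<noteq> Y y" using YX xy by auto
    moreover have "finite (components ?D)"
    proof -
      have "finite (verts K)" using wf by (simp add: K_def induced_def wf_mgraph_def)
      then show ?thesis by (simp add: components_def vD)
    qed
    then have "card {Y x, Y y} \<le> card (components ?D)"
      using Yc xyK by (intro card_mono) auto
    moreover have "card (components K) \<le> card {K}"
      using components_component[OF wf xH(1)] unfolding K_def by (intro card_mono) auto
    ultimately have "cutedge K {x, y}" using xyK(3) by (simp add: cutedge_def)
    then obtain v where "v \<in> verts (Y x)" "deg H v \<le> r - 2" using cutedges K Yc xyK by blast
    then have "1 \<le> (\<Sum>v\<in>X. r - mdeg a n v)" using slack_sum[of v 1] YX r by auto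
    then show ?thesis using cut_a 3 by simp
  qed
qed

section \<open>Connectedness read off from cuts\<close>

lemma connected_of_cuts:
  fixes H :: "nat mgraph"
  assumes "verts H = {..<m}" and "0 < m"
    and "\<And>X. X \<subseteq> {..<m} \<Longrightarrow> X \<noteq> {} \<Longrightarrow> X \<noteq> {..<m} \<Longrightarrow> 0 < cut_size (count (edges H)) m X"
  shows "connected_mgraph H"
proof -
  have "reachable H u v" if "u < m" "v < m" for u v
  proof (rule ccontr)
    assume no: "\<not> reachable H u v"
    \<comment> \<open>No edge leaves the set of vertices reachable from \<open>u\<close>, so its cut
      would be empty.\<close>
    let ?R = "{w. w < m \<and> reachable H u w}"
    have "u \<in> ?R" "v \<notin> ?R" using that no by (auto simp: reachable_refl)
    then have "?R \<noteq> {}" "?R \<noteq> {..<m}" "?R \<subseteq> {..<m}" using that by blast+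
    then have "0 < cut_size (count (edges H)) m ?R" by (intro assms(3))
    then obtain x y where "x \<in> ?R" "y \<in> {..<m} - ?R" "0 < count (edges H) {x, y}"
      unfolding cut_size_def by (metis (no_types, lifting) gr0I less_irrefl sum.neutral)
    then show False using reachable_trans reachable_edge by (fastforce simp: count_greater_zero_iff)
  qed
  then show ?thesis using assms(1,2) by (auto simp: connected_mgraph_def)
qed

lemma cut_del_edge:
  fixes H :: "nat mgraph"
  shows "cut_size (count (edges H)) m X \<le> cut_size (count (edges (del_edge H e))) m X + 1"
proof (cases "finite X")
  case False
  then show ?thesis by (simp add: cut_size_def)
next
  case True
  \<comment> \<open>Of the two orientations of \<open>e\<close>, at most one starts in
    \<open>X\<close> and ends outside.\<close>
  let ?B = "{q \<in> X \<times> ({..<m} - X). {fst q, snd q} = e}"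
  have fin: "finite ?B" using True by simp
  have "q = q'" if "q \<in> ?B" "q' \<in> ?B" for q q'
    using that by (cases q; cases q') (auto simp: doubleton_eq_iff)
  then have le1: "card ?B \<le> 1" using card_le_Suc0_iff_eq[OF fin] by auto
  have "cut_size (count (edges H)) m X = (\<Sum>q\<in>X \<times> ({..<m} - X). count (edges H) {fst q, snd q})"
    by (simp add: cut_size_def sum.cartesian_product case_prod_beta)
  also have "\<dots> \<le> (\<Sum>q\<in>X \<times> ({..<m} - X). count (edges (del_edge H e)) {fst q, snd q}
      + (if {fst q, snd q} = e then 1 else 0))"
    by (intro sum_mono) (auto simp: del_edge_def)
  also have "\<dots> = cut_size (count (edges (del_edge H e))) m X + card ?B"
    using True by (simp add: sum.distrib cut_size_def sum.cartesian_product case_prod_beta sum.inter_filter[symmetric])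
  finally show ?thesis using le1 by simp
qed

lemma two_edge_connected_of_cuts:
  fixes H :: "nat mgraph"
  assumes "verts H = {..<m}" and "0 < m"
    and cuts: "\<And>X. X \<subseteq> {..<m} \<Longrightarrow> X \<noteq> {} \<Longrightarrow> X \<noteq> {..<m} \<Longrightarrow> 2 \<le> cut_size (count (edges H)) m X"
  shows "two_edge_connected H"
  unfolding two_edge_connected_def
proof (intro conjI ballI)
  show "connected_mgraph H"
  proof (rule connected_of_cuts[OF assms(1,2)])
    show "0 < cut_size (count (edges H)) m X" if "X \<subseteq> {..<m}" "X \<noteq> {}" "X \<noteq> {..<m}" for X
      using cuts[OF that] by simp
  qed
  show "connected_mgraph (del_edge H e)" for e
  proof (rule connected_of_cuts)
    show "verts (del_edge H e) = {..<m}" using assms(1) by (simp add: del_edge_def)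
    show "0 < cut_size (count (edges (del_edge H e))) m X" if "X \<subseteq> {..<m}" "X \<noteq> {}" "X \<noteq> {..<m}" for X
      using cuts[OF that] cut_del_edge[of H m X e] by linarith
  qed fact
qed

definition mgraph_of :: "nat \<Rightarrow> (nat set \<Rightarrow> nat) \<Rightarrow> nat mgraph" where
  "mgraph_of n b = \<lparr>verts = {..<n}, edges = (\<Sum>e\<in>pairs n. replicate_mset (b e) e)\<rparr>"

lemma verts_mgraph_of [simp]: "verts (mgraph_of n b) = {..<n}"
  by (simp add: mgraph_of_def)

lemma count_mgraph_of: "count (edges (mgraph_of n b)) e = (if e \<in> pairs n then b e else 0)"
  by (simp add: mgraph_of_def count_sum if_distrib cong: if_cong)

lemma wf_mgraph_of: "wf_mgraph (mgraph_of n b)"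
proof -
  have "e \<in> pairs n" if "e \<in># edges (mgraph_of n b)" for e
    using that count_mgraph_of[of n b e] by (metis not_in_iff)
  then show ?thesis by (auto simp: wf_mgraph_def pairs_def)
qed

lemma mdeg_mgraph_of: "v < n \<Longrightarrow> mdeg (count (edges (mgraph_of n b))) n v = mdeg b n v"
  by (auto simp: mdeg_def count_mgraph_of doubleton_in_pairs intro!: sum.cong)

lemma cut_mgraph_of: "X \<subseteq> {..<n} \<Longrightarrow> cut_size (count (edges (mgraph_of n b))) n X = cut_size b n X"
  unfolding cut_size_def by (intro sum.cong) (auto simp: count_mgraph_of doubleton_in_pairs)

lemma factorization_of_multiplicities:
  assumes "0 < m"
    and total: "\<And>e. e \<in> pairs m \<Longrightarrow> (\<Sum>i\<in>{1..k}. b i e) = \<mu>"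
    and degree: "\<And>i v. i \<in> {1..k} \<Longrightarrow> v < m \<Longrightarrow> mdeg (b i) m v = r"
    and cuts: "\<And>i X. i \<in> {1..k} \<Longrightarrow> X \<subseteq> {..<m} \<Longrightarrow> X \<noteq> {} \<Longrightarrow> X \<noteq> {..<m} \<Longrightarrow> 2 \<le> cut_size (b i) m X"
  shows "two_edge_connected_factorization r k (\<lambda>i. mgraph_of m (b i)) (complete_mgraph \<mu> m)"
  unfolding two_edge_connected_factorization_def
proof (intro conjI ballI)
  let ?E = "repeat_mset \<mu> (mset_set (pairs m))"
  have count_E: "count ?E e = (if e \<in> pairs m then \<mu> else 0)" for e by simp
  have wfK: "wf_mgraph (complete_mgraph \<mu> m)"
    using subgraph_complete_mgraph[of \<mu> \<mu> m m] by (simp add: subgraph_def)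
  have sub: "edges (mgraph_of m (b i)) \<subseteq># ?E" if i: "i \<in> {1..k}" for i
  proof (rule mset_subset_eqI)
    fix e
    have "b i e \<le> (\<Sum>i\<in>{1..k}. b i e)" using i by (intro member_le_sum) auto
    then show "count (edges (mgraph_of m (b i))) e \<le> count ?E e"
      using total[of e] by (cases "e \<in> pairs m") (simp_all add: count_mgraph_of)
  qed
  have sum: "(\<Sum>i\<in>{1..k}. edges (mgraph_of m (b i))) = ?E"
  proof (rule multiset_eqI)
    show "count (\<Sum>i\<in>{1..k}. edges (mgraph_of m (b i))) e = count ?E e" for e
      using total[of e] by (cases "e \<in> pairs m") (simp_all add: count_sum count_mgraph_of)
  qed
  show "decomposition k (\<lambda>i. mgraph_of m (b i)) (complete_mgraph \<mu> m)"
    using sub sum wfK wf_mgraph_of[of m]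
    by (simp add: decomposition_def spanning_subgraph_def subgraph_def complete_mgraph_pairs)
  fix i assume i: "i \<in> {1..k}"
  show "regular r (mgraph_of m (b i))"
    using degree[OF i] by (simp add: regular_def deg_eq_mdeg[OF wf_mgraph_of] mdeg_mgraph_of)
  show "two_edge_connected (mgraph_of m (b i))"
  proof (rule two_edge_connected_of_cuts)
    show "2 \<le> cut_size (count (edges (mgraph_of m (b i)))) m X"
      if "X \<subseteq> {..<m}" "X \<noteq> {}" "X \<noteq> {..<m}" for X
      using cuts[OF i that] cut_mgraph_of[OF that(1)] by simp
  qed (use assms(1) in simp_all)
qed

section \<open>Enclosing an admissible decomposition\<close>

lemma admissible_extendable:
  assumes dec: "decomposition k G (complete_mgraph l n)" and adm: "admissible (r - 1) k G" and r: "3 \<le> r"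
    and l: "l \<le> \<mu>"
    and M_sum: "\<And>e. e \<in> pairs n \<Longrightarrow> (\<Sum>i\<in>{1..k}. M i e) = \<mu> - l"
    and M_dg: "\<And>i v. i \<in> {1..k} \<Longrightarrow> v < n \<Longrightarrow> mdeg (M i) n v \<le> 1"
    and large: "\<And>i. i \<in> {1..k} \<Longrightarrow> r * n \<le> r * (m - n) + (\<Sum>v<n. mdeg (M i) n v)"
  shows "extendable \<mu> r k m n (\<lambda>i e. count (edges (G i)) e + M i e)"
proof -
  let ?a = "\<lambda>i e. count (edges (G i)) e + M i e"
  have G: "wf_mgraph (G i)" "verts (G i) = {..<n}" if "i \<in> {1..k}" for i
    using dec that by (auto simp: decomposition_def spanning_subgraph_def subgraph_def complete_mgraph_pairs)
  have "(\<Sum>i\<in>{1..k}. ?a i e) = \<mu>" if e: "e \<in> pairs n" for e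
  proof -
    have "(\<Sum>i\<in>{1..k}. count (edges (G i)) e) = count (\<Sum>i\<in>{1..k}. edges (G i)) e"
      by (simp add: count_sum)
    also have "\<dots> = l" using dec e by (simp add: decomposition_def complete_mgraph_pairs)
    finally show ?thesis using M_sum[OF e] l by (simp add: sum.distrib)
  qed
  moreover have "(\<forall>v<n. mdeg (?a i) n v \<le> r) \<and> r * n \<le> r * (m - n) + (\<Sum>v<n. mdeg (?a i) n v) \<and>
      (\<forall>X\<subseteq>{..<n}. X \<noteq> {} \<longrightarrow> 2 \<le> cut_size (?a i) n X + (\<Sum>v\<in>X. r - mdeg (?a i) n v))"
    if i: "i \<in> {1..k}" for i
  proof (intro conjI allI impI)
    have dg_a: "mdeg (?a i) n v = deg (G i) v + mdeg (M i) n v" if "v < n" for v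
      unfolding deg_eq_mdeg[OF G[OF i] that] by (simp add: mdeg_def sum.distrib)
    have deg_le: "deg (G i) v \<le> r - 1" if "v < n" for v
      using adm i that G(2)[OF i] by (auto simp: admissible_def)
    show "mdeg (?a i) n v \<le> r" if "v < n" for v
      using dg_a[OF that] deg_le[OF that] M_dg[OF i that] r by simp
    \<comment> \<open>The degrees in \<open>G i\<close> are bounded below by zero only, so the
      matching has to provide the whole degree sum.\<close>
    have "(\<Sum>v<n. mdeg (M i) n v) \<le> (\<Sum>v<n. mdeg (?a i) n v)"
      using dg_a by (intro sum_mono) auto
    then show "r * n \<le> r * (m - n) + (\<Sum>v<n. mdeg (?a i) n v)" using large[OF i] by linarith
    fix X assume X: "X \<subseteq> {..<n}" "X \<noteq> {}"
    have s: "r - 1 - 2 = r - 3" "r - 1 - 1 = r - 2" by simp_all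
    show "2 \<le> cut_size (?a i) n X + (\<Sum>v\<in>X. r - mdeg (?a i) n v)"
    proof (rule admissible_add_matching[OF G[OF i] r deg_le _ _ M_dg[OF i] X])
      show "(\<exists>v\<in>verts K. deg (G i) v \<le> r - 3) \<or>
          (\<exists>u\<in>verts K. \<exists>v\<in>verts K. u \<noteq> v \<and> deg (G i) u \<le> r - 2 \<and> deg (G i) v \<le> r - 2)"
        if "K \<in> components (G i)" for K
        using adm i that unfolding admissible_def s by blast
      show "\<exists>v\<in>verts Y. deg (G i) v \<le> r - 2"
        if "K \<in> components (G i)" "cutedge K e" "Y \<in> components (del_edge K e)" for K e Y
        using adm i that unfolding admissible_def s by blast
    qed
  qed
  ultimately show ?thesis unfolding extendable_def by blast
qed

lemma enclosing_exists:
  fixes l \<mu> r k m n :: nat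
  assumes l: "l \<le> \<mu>" and r: "3 \<le> r" and mu: "r * (\<mu> - l) < 2 * \<mu>"
    and C: "0 \<le> C" "l < \<mu> \<Longrightarrow> C = 1 / (r * (2 * \<mu> + 1))" "l = \<mu> \<Longrightarrow> C = 0"
    and n: "0 < n" and rk: "r * k = \<mu> * (m - 1)" and ev: "even (r * m)"
    and dec: "decomposition k G (complete_mgraph l n)" and adm: "admissible (r - 1) k G"
    and m: "real m \<ge> (2 - C) * real n + 1"
  shows "\<exists>H. two_edge_connected_factorization r k H (complete_mgraph \<mu> m) \<and> enclosed k G H"
proof -
  define \<delta> where "\<delta> = \<mu> - l"
  \<comment> \<open>Bounds the number of colors that share one copy of a matching when
    \<open>m < 2 * n\<close>.\<close>
  define q where "q = 2 * \<mu> + 1"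
  have mu0: "0 < \<mu>" using mu by (cases \<mu>) auto
  have C_mu: "C * (r * q) \<le> 1" "C * \<mu> \<le> 1"
  proof -
    have "C = 0 \<or> C = 1 / (r * q)" using C l unfolding q_def by (cases "l = \<mu>") auto
    moreover have "0 < r * q" using r by (simp add: q_def)
    ultimately show 1: "C * (r * q) \<le> 1" by (auto simp: field_simps)
    have "\<mu> \<le> q" by (simp add: q_def)
    moreover have "1 * q \<le> r * q" using r by (intro mult_right_mono) auto
    ultimately have "\<mu> \<le> r * q" by linarith
    then have "real \<mu> \<le> real (r * q)" by (rule of_nat_mono)
    then show "C * \<mu> \<le> 1" using 1 mult_left_mono[of "real \<mu>" "real (r * q)" C] C(1) by simp
  qed
  have "C \<le> C * \<mu>" using C(1) mu0 by (simp add: mult_le_cancel_left1)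
  then have "C \<le> 1" using C_mu(2) by simp
  then have "1 * real n \<le> (2 - C) * real n" by (intro mult_right_mono) auto
  then have nm: "n < m" using m by linarith
  \<comment> \<open>After multiplication by \<open>r\<close>:
    \<open>r * \<delta> \<le> 2 * \<mu> - 1 \<le> \<mu> * (2 - C)\<close>, and
    \<open>(2 - C) * n \<le> m - 1\<close>, while \<open>\<mu> * (m - 1) = r * k\<close>.\<close>
  have "\<delta> * n \<le> k"
  proof -
    have "r * \<delta> + 1 \<le> 2 * \<mu>" using mu by (simp add: \<delta>_def)
    then have "real (r * \<delta>) + 1 \<le> 2 * real \<mu>" by linarith
    then have "real (r * \<delta>) \<le> \<mu> * (2 - C)" using C_mu(2) by (simp add: algebra_simps)
    then have "real (r * \<delta>) * n \<le> \<mu> * (2 - C) * n" by (intro mult_right_mono) auto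
    also have "\<dots> \<le> \<mu> * (real m - 1)"
      using m mu0 by (simp add: mult.assoc)
    also have "\<dots> = real (r * k)" using rk nm by (simp add: of_nat_diff)
    finally have "real (r * (\<delta> * n)) \<le> real (r * k)" by (simp add: mult.assoc)
    then have "r * (\<delta> * n) \<le> r * k" by linarith
    then show ?thesis using r by simp
  qed
  then obtain M :: "nat \<Rightarrow> nat set \<Rightarrow> nat" where
    M: "\<forall>e\<in>pairs n. (\<Sum>i\<in>{1..k}. M i e) = \<delta>"
      "\<forall>i\<in>{1..k}. (\<forall>v<n. mdeg (M i) n v \<le> 1) \<and>
        (\<forall>q. 0 < \<delta> \<longrightarrow> k \<le> q * (\<delta> * n) \<longrightarrow> n \<le> q * (\<Sum>v<n. mdeg (M i) n v) + 2 * q)"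
    using balanced_matchings[OF n] by blast
  have large: "r * n \<le> r * (m - n) + (\<Sum>v<n. mdeg (M i) n v)" if i: "i \<in> {1..k}" for i
  proof (cases "2 * n \<le> m")
    case True
    \<comment> \<open>At least as many vertices are new as old, so the old ones cannot demand more
      ends than are available.\<close>
    then have "r * n \<le> r * (m - n)" by (intro mult_left_mono) auto
    then show ?thesis by linarith
  next
    case False
    have "0 < \<delta>"
    proof (rule ccontr)
      assume "\<not> 0 < \<delta>"
      then have "C = 0" using C(3) l by (simp add: \<delta>_def)
      then show False using m False by simp
    qed
    have "k \<le> r * k" using r by simp
    also have "\<dots> \<le> \<mu> * (2 * n)" unfolding rk using False by (intro mult_left_mono) auto
    also have "\<dots> \<le> q * n" by (simp add: q_def)
    also have "\<dots> \<le> q * (\<delta> * n)" using \<open>0 < \<delta>\<close> by (intro mult_left_mono) auto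
    finally have "k \<le> q * (\<delta> * n)" .
    then have nq: "n \<le> q * (\<Sum>v<n. mdeg (M i) n v) + 2 * q" using M(2) i \<open>0 < \<delta>\<close> by blast
    \<comment> \<open>After scaling by \<open>r * q\<close>, the term \<open>C * n\<close> becomes
      at most \<open>n\<close>, and the \<open>1\<close> from the bound on \<open>m\<close> becomes
      \<open>r * q\<close>, which exceeds the error \<open>2 * q\<close> of the matchings.\<close>
    have "2 * real n - m \<le> C * n - 1" using m by (simp add: algebra_simps)
    then have "(r * q) * (2 * real n - m) \<le> (r * q) * (C * n - 1)" by (intro mult_left_mono) auto
    also have "\<dots> = (C * (r * q)) * n - r * q" by (simp add: algebra_simps)
    also have "(C * (r * q)) * n \<le> 1 * real n" using C_mu(1) by (intro mult_right_mono) auto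
    also have "1 * real n - r * q \<le> q * (\<Sum>v<n. mdeg (M i) n v)"
    proof -
      have "2 * q \<le> r * q" using r by simp
      then have "n \<le> q * (\<Sum>v<n. mdeg (M i) n v) + r * q" using nq by linarith
      then have "real n \<le> real (q * (\<Sum>v<n. mdeg (M i) n v) + r * q)" by (rule of_nat_mono)
      then show ?thesis by simp
    qed
    finally have "real q * (r * (2 * real n - m)) \<le> real q * (\<Sum>v<n. mdeg (M i) n v)"
      by (simp add: mult_ac)
    then have "r * (2 * real n - m) \<le> (\<Sum>v<n. mdeg (M i) n v)"
      by (simp add: q_def)
    then have "real r * real n \<le> real r * (real m - real n) + real (\<Sum>v<n. mdeg (M i) n v)"
      by (simp add: algebra_simps)
    then have "real (r * n) \<le> real (r * (m - n) + (\<Sum>v<n. mdeg (M i) n v))"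
      by (simp only: of_nat_add of_nat_mult of_nat_diff[OF less_imp_le[OF nm]])
    then show ?thesis by linarith
  qed
  have "extendable \<mu> r k m n (\<lambda>i e. count (edges (G i)) e + M i e)"
    using M large by (intro admissible_extendable[OF dec adm r l]) (auto simp: \<delta>_def)
  from extend_to_factorization[OF this rk ev r nm] obtain b where
    b: "\<forall>e\<in>pairs m. (\<Sum>i\<in>{1..k}. b i e) = \<mu>"
      "\<forall>i\<in>{1..k}. \<forall>e\<in>pairs n. b i e = count (edges (G i)) e + M i e"
      "\<forall>i\<in>{1..k}. (\<forall>v<m. mdeg (b i) m v = r) \<and>
        (\<forall>X\<subseteq>{..<m}. X \<noteq> {} \<longrightarrow> X \<noteq> {..<m} \<longrightarrow> 2 \<le> cut_size (b i) m X)"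
    by blast
  have "two_edge_connected_factorization r k (\<lambda>i. mgraph_of m (b i)) (complete_mgraph \<mu> m)"
    using b nm by (intro factorization_of_multiplicities) auto
  moreover have "enclosed k G (\<lambda>i. mgraph_of m (b i))"
    unfolding enclosed_def
  proof
    fix i assume i: "i \<in> {1..k}"
    have G: "wf_mgraph (G i)" "verts (G i) = {..<n}"
      using dec i by (auto simp: decomposition_def spanning_subgraph_def subgraph_def complete_mgraph_pairs)
    have "count (edges (G i)) e \<le> count (edges (mgraph_of m (b i))) e" for e
    proof (cases "e \<in># edges (G i)")
      case True
      then have "e \<in> pairs n" using wf_mgraph_pairs[OF G] by blast
      moreover have "pairs n \<subseteq> pairs m" using nm by (intro pairs_mono) simp
      ultimately show ?thesis using b(2) i by (auto simp: count_mgraph_of)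
    qed (simp add: not_in_iff)
    then have "edges (G i) \<subseteq># edges (mgraph_of m (b i))" by (rule mset_subset_eqI)
    then show "subgraph (G i) (mgraph_of m (b i))"
      using G nm wf_mgraph_of[of m] by (auto simp: subgraph_def)
  qed
  ultimately show ?thesis by blast
qed

text \<open>\<open>C\<close> is chosen before \<open>k\<close>, \<open>m\<close>, \<open>n\<close>
  and \<open>G\<close>. The sign conditions keep a negative \<open>C\<close> from weakening the
  claim: for \<open>l < \<mu>\<close> the threshold lies strictly below \<open>2 * n + 1\<close>,
  and for \<open>l = \<mu>\<close>, where the matchings are empty, it equals
  \<open>2 * n + 1\<close> with the choice \<open>C = 0\<close>.\<close>

theorem theorem1p4:
  fixes l \<mu> r :: nat
  assumes "0 < l" and "l \<le> \<mu>" and "3 \<le> r" and "2 * \<mu> > r * (\<mu> - l)"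
  shows "\<exists>C::real. 0 \<le> C \<and> (l < \<mu> \<longrightarrow> 0 < C) \<and>
    (\<forall>(k::nat) (m::nat) (n::nat) (G :: nat \<Rightarrow> nat mgraph).
       0 < k \<longrightarrow> 0 < m \<longrightarrow> 0 < n \<longrightarrow> n \<le> m \<longrightarrow>
       r * k = \<mu> * (m - 1) \<longrightarrow> even (r * m) \<longrightarrow>
       decomposition k G (complete_mgraph l n) \<longrightarrow> admissible (r - 1) k G \<longrightarrow>
       real m \<ge> (2 - C) * real n + 1 \<longrightarrow>
       (\<exists>H. two_edge_connected_factorization r k H (complete_mgraph \<mu> m) \<and> enclosed k G H))"
proof -
  define C where "C = (if l < \<mu> then 1 / real (r * (2 * \<mu> + 1)) else 0)"
  have "0 < r * (2 * \<mu> + 1)" using assms(3) by (intro mult_pos_pos) auto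
  then have "0 < 1 / real (r * (2 * \<mu> + 1))" by (simp only: zero_less_divide_1_iff of_nat_0_less_iff)
  then have "l < \<mu> \<longrightarrow> 0 < C" unfolding C_def by presburger
  moreover have "0 \<le> C" by (simp add: C_def)
  moreover have "\<exists>H. two_edge_connected_factorization r k H (complete_mgraph \<mu> m) \<and> enclosed k G H"
    if "0 < n" "r * k = \<mu> * (m - 1)" "even (r * m)" "decomposition k G (complete_mgraph l n)"
      "admissible (r - 1) k G" "real m \<ge> (2 - C) * real n + 1" for k m n G
    using assms(2-4) \<open>0 \<le> C\<close> _ _ that by (rule enclosing_exists) (simp_all add: C_def)
  ultimately show ?thesis by blast
qed

end
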